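(* Let $*:\hat S\to\widehat{{}^*S}$ be an enlargement, and let $G:\mathcal I\to\mathcal C$ be a covariant functor of $\hat S$-small categories. (i) Assume that $\mathcal I$ is cofiltered, and let $i_{-\infty}\in\mathrm{Ob}({}^*\mathcal I)$ and $\{p_i:i_{-\infty}\to{}^*i\}_{i\in\mathrm{Ob}(\mathcal I)}$ be such that ${}^*\varphi\circ p_{i_1}=p_{i_2}$ for every morphism $\varphi:i_1\to i_2$ in $\mathcal I$. Define the presheaf $\tilde G$ on $\mathcal C$ by $\tilde G(X)=\mathrm{Mor}_{{}^*\mathcal C}({}^*X,({}^*G)(i_{-\infty}))$, define the subpresheaf $\tilde G^{\mathrm{fin}}$ of $\tilde G$ by $$\tilde G^{\mathrm{fin}}(X)=\{\varphi\in\tilde G(X)\mid\forall i\in\mathrm{Ob}(\mathcal I)\ \exists\varphi_i\in\mathrm{Mor}_{\mathcal C}(X,G(i)):({}^*G)(p_i)\circ\varphi={}^*\varphi_i\},$$ and define an equivalence relation $\sim$ on $\tilde G^{\mathrm{fin}}$ by: for $X\in\mathrm{Ob}(\mathcal C)$ and $\varphi,\psi\in\tilde G^{\mathrm{fin}}(X)$, $\varphi\sim\psi$ iff $({}^*G)(p_i)\circ\varphi=({}^*G)(p_i)\circ\psi$ for all $i\in\mathrm{Ob}(\mathcal I)$. Then there is a canonical monomorphism $\varprojlim G\hookrightarrow\tilde G$ of presheaves on $\mathcal C$ that induces an isomorphism $\varprojlim G\xrightarrow{\sim}\tilde G^{\mathrm{fin}}/{\sim}$. If in addition $\mathrm{Mor}_{\mathcal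 C}(X,G(i))$ is finite for all $X\in\mathrm{Ob}(\mathcal C)$ and $i\in\mathrm{Ob}(\mathcal I)$, then $\tilde G^{\mathrm{fin}}=\tilde G$. Moreover the following square of presheaves on $\mathcal C$ commutes: the composite of $\varprojlim G\xrightarrow{\sim}\tilde G^{\mathrm{fin}}/{\sim}$ with the monomorphism $\tilde G^{\mathrm{fin}}/{\sim}\hookrightarrow\prod_{i\in\mathrm{Ob}(\mathcal I)}[X\mapsto\mathrm{Mor}_{{}^*\mathcal C}({}^*X,{}^*G({}^*i))]$, $\varphi\mapsto(({}^*G)(p_i)\circ\varphi)_i$, equals the composite of the monomorphism $\varprojlim G\hookrightarrow\prod_{i}\mathrm{Mor}_{\mathcal C}(\_,G(i))$ given by the projections with the map induced by $*$. (ii) Assume that $\mathcal I$ is filtered, and let $i_\infty\in\mathrm{Ob}({}^*\mathcal I)$ and $\{\iota_i:{}^*i\to i_\infty\}_{i\in\mathrm{Ob}(\mathcal I)}$ be such that $\iota_{i_2}\circ{}^*\varphi=\iota_{i_1}$ for every morphism $\varphi:i_1\to i_2$ in $\mathcal I$. Define the presheaf $\tilde G$ on $\mathcal C^\circ$ by $\tilde G(X)=\mathrm{Mor}_{{}^*\mathcal C}(({}^*G)(i_\infty),{}^*X)$, define the subpresheaf $\tilde G^{\mathrm{fin}}$ by $$\tilde G^{\mathrm{fin}}(X)=\{\varphi\in\tilde G(X)\mid\forall i\in\mathrm{Ob}(\mathcal I)\ \exists\varphi_i\in\mathrm{Mor}_{\mathcal C}(G(i),X):\varphi\circ({}^*G)(\iota_i)={}^*\varphi_i\},$$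 and define an equivalence relation $\sim$ on $\tilde G^{\mathrm{fin}}$ by: $\varphi\sim\psi$ iff $\varphi\circ({}^*G)(\iota_i)=\psi\circ({}^*G)(\iota_i)$ for all $i\in\mathrm{Ob}(\mathcal I)$. Then there is a canonical monomorphism $\varinjlim G\hookrightarrow\tilde G$ of presheaves on $\mathcal C^\circ$ that induces an isomorphism $\varinjlim G\xrightarrow{\sim}\tilde G^{\mathrm{fin}}/{\sim}$. If in addition $\mathrm{Mor}_{\mathcal C}(G(i),X)$ is finite for all $X\in\mathrm{Ob}(\mathcal C)$ and $i\in\mathrm{Ob}(\mathcal I)$, then $\tilde G^{\mathrm{fin}}=\tilde G$. Moreover the following square of presheaves on $\mathcal C^\circ$ commutes: the composite of $\varinjlim G\xrightarrow{\sim}\tilde G^{\mathrm{fin}}/{\sim}$ with the monomorphism $\tilde G^{\mathrm{fin}}/{\sim}\hookrightarrow\prod_{i}[X\mapsto\mathrm{Mor}_{{}^*\mathcal C}({}^*G({}^*i),{}^*X)]$, $\varphi\mapsto(\varphi\circ({}^*G)(\iota_i))_i$, equals the composite of the monomorphism $\varinjlim G\hookrightarrow\prod_{i}\mathrm{Mor}_{\mathcal C}(G(i),\_)$ given by the projections with the map induced by $*$.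
   Context: Superstructures: a base set $S$ is an infinite set whose elements are not sets; $S_0=S$, $S_n=S_{n-1}\cup\mathcal P(S_{n-1})$, and $\hat S=\bigcup_{n\ge 0}S_n$. Formulas in $\hat S$ are built from $=$, $\in$, constants in $\hat S$, variables, ordered pairs and function application by $\neg$, $\wedge$ and bounded quantifiers $\forall x\in t$; statements are formulas without free variables. For $\varphi$ a formula in $\hat S$, ${}^*\varphi$ is obtained by replacing each constant $\tau$ by ${}^*\tau$. Enlargement: a map $*:\hat S\to\hat W$ between superstructures with (1) ${}^*S=W$; (2) ${}^*s=s$ for $s\in S$; (3) (transfer) a statement $\varphi$ in $\hat S$ is true iff ${}^*\varphi$ is true; (4) (saturation) with $\mathcal J=\bigcup_{A\in\hat S\setminus S}{}^*A$ (the internal elements), every nonempty family $\{U_i\}_{i\in I}$ of nonempty sets $U_i\in\mathcal J$ with $|I|\le|\hat S|$ and the finite intersection property has nonempty intersection. $\hat S$-small category: a category $\mathcal C=\langle M,s,t,c\rangle$ given by its set of morphisms $M\in\hat S\setminus S$, the maps $s,t:M\to M$ sending a morphism to the identity of its source resp. target, and the composition relation $c=\{\langle f,g,h\rangle: f\circ g=h\}$; objects are identified with their identity morphisms. Its enlargement is the category ${}^*\mathcal C=\langle{}^*M,{}^*s,{}^*t,{}^*c\rangle$; a functor $G$ (a map on morphism sets) has an enlargement ${}^*G$, a functor between the enlarged categories. A category $\mathcal I$ is cofiltered if it is nonempty; for any two objects $i_1,i_2$ there are morphisms $j\to i_1$, $j\to i_2$; for any $\varphi_1:i_1\to i$, $\varphi_2:i_2\to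 i$ there are $\psi_1:j\to i_1$, $\psi_2:j\to i_2$ with $\varphi_1\psi_1=\varphi_2\psi_2$; and for any $\varphi_1,\varphi_2:i_1\to i_2$ there is $\psi:j\to i_1$ with $\varphi_1\psi=\varphi_2\psi$. $\mathcal I$ is filtered if $\mathcal I^\circ$ is cofiltered. A presheaf on a category is a contravariant functor to sets; thus a presheaf on $\mathcal C^\circ$ is a covariant functor on $\mathcal C$. $\varprojlim G$ denotes the presheaf $X\mapsto\varprojlim_{i}\mathrm{Mor}_{\mathcal C}(X,G(i))$ on $\mathcal C$, and $\varinjlim G$ denotes the presheaf $X\mapsto\varprojlim_{i}\mathrm{Mor}_{\mathcal C}(G(i),X)$ on $\mathcal C^\circ$. *)

theory Defs
  imports "HOL-Library.FuncSet" "HOL-Library.Equipollence"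
begin

section \<open>Sets over atoms, superstructures\<close>

text \<open>
  HOL has no type containing all the iterated power sets of an infinite set. We therefore work in an
  arbitrary ambient type of atoms and sets. Both superstructures of an enlargement live in it:
  since the enlarging map fixes the elements of the base set, the first one is contained in the second.
  The only set-theoretic axioms imposed on the ambient type are extensionality and the existence of
  finite sets (hence of ordered pairs); the full power sets needed for the superstructure over \<open>S\<close>
  are part of the predicate \<open>base_set\<close> below.
\<close>

class set_universe =
  fixes mem :: "'a \<Rightarrow> 'a \<Rightarrow> bool"  (infix "\<epsilon>" 50)
    and is_set :: "'a \<Rightarrow> bool"
  assumes mem_is_set: "x \<epsilon> y \<Longrightarrow> is_set y"
    and set_ext: "is_set x \<Longrightarrow> is_set y \<Longrightarrow> (\<And>z. z \<epsilon> x \<longleftrightarrow> z \<epsilon> y) \<Longrightarrow> x = y"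
    and finite_set_ex: "finite A \<Longrightarrow> \<exists>y. is_set y \<and> (\<forall>z. z \<epsilon> y \<longleftrightarrow> z \<in> A)"

definition elts :: "'u::set_universe \<Rightarrow> 'u set" where
  "elts y = {x. x \<epsilon> y}"

text \<open>The set of the universe with the given elements; meaningful only if there is one.\<close>

definition code_set :: "'u::set_universe set \<Rightarrow> 'u" where
  "code_set A = (THE y. is_set y \<and> elts y = A)"

primrec level :: "'u::set_universe set \<Rightarrow> nat \<Rightarrow> 'u set" where
  "level S 0 = S"
| "level S (Suc n) = level S n \<union> {x. is_set x \<and> elts x \<subseteq> level S n}"

definition superstr :: "'u::set_universe set \<Rightarrow> 'u set" where
  "superstr S = (\<Union>n. level S n)"

text \<open>
  The last clause says that \<open>{x. is_set x \<and> elts x \<subseteq> level S n}\<close> is the full power set of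
  \<open>level S n\<close>.
\<close>

definition base_set :: "'u::set_universe set \<Rightarrow> bool" where
  "base_set S \<longleftrightarrow> infinite S \<and> (\<forall>s\<in>S. \<not> is_set s) \<and>
     (\<forall>n. \<forall>A\<subseteq>level S n. \<exists>y. is_set y \<and> elts y = A)"

definition opair :: "'u::set_universe \<Rightarrow> 'u \<Rightarrow> 'u" where
  "opair a b = code_set {code_set {a}, code_set {a, b}}"

definition otriple :: "'u::set_universe \<Rightarrow> 'u \<Rightarrow> 'u \<Rightarrow> 'u" where
  "otriple a b c = opair (opair a b) c"

text \<open>Function application is made total: it yields the empty set where it is not defined.\<close>

definition app :: "'u::set_universe \<Rightarrow> 'u \<Rightarrow> 'u" where
  "app f x = (if \<exists>!y. opair x y \<epsilon> f then (THE y. opair x y \<epsilon> f) else code_set {})"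

definition graph :: "'u::set_universe set \<Rightarrow> ('u \<Rightarrow> 'u) \<Rightarrow> 'u" where
  "graph A f = code_set ((\<lambda>x. opair x (f x)) ` A)"


section \<open>Formulas and enlargements\<close>

datatype (tm_constants: 'u) tm =
    Cst 'u
  | Var nat
  | Tup "'u tm" "'u tm"
  | App "'u tm" "'u tm"
  for map: map_tm

datatype (fm_constants: 'u) fm =
    Eq "'u tm" "'u tm"
  | Mem "'u tm" "'u tm"
  | Neg "'u fm"
  | Conj "'u fm" "'u fm"
  | BAll nat "'u tm" "'u fm"
  for map: map_fm

primrec tm_vars :: "'u tm \<Rightarrow> nat set" where
  "tm_vars (Cst c) = {}"
| "tm_vars (Var v) = {v}"
| "tm_vars (Tup t1 t2) = tm_vars t1 \<union> tm_vars t2"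
| "tm_vars (App t1 t2) = tm_vars t1 \<union> tm_vars t2"

text \<open>In \<open>BAll v t \<phi>\<close>, that is \<open>\<forall>v \<in> t. \<phi>\<close>, the variable \<open>v\<close> is bound in \<open>\<phi>\<close> but not in \<open>t\<close>.\<close>

primrec free_vars :: "'u fm \<Rightarrow> nat set" where
  "free_vars (Eq t1 t2) = tm_vars t1 \<union> tm_vars t2"
| "free_vars (Mem t1 t2) = tm_vars t1 \<union> tm_vars t2"
| "free_vars (Neg \<phi>) = free_vars \<phi>"
| "free_vars (Conj \<phi> \<psi>) = free_vars \<phi> \<union> free_vars \<psi>"
| "free_vars (BAll v t \<phi>) = tm_vars t \<union> (free_vars \<phi> - {v})"

primrec tm_val :: "(nat \<Rightarrow> 'u::set_universe) \<Rightarrow> 'u tm \<Rightarrow> 'u" where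
  "tm_val e (Cst c) = c"
| "tm_val e (Var v) = e v"
| "tm_val e (Tup t1 t2) = opair (tm_val e t1) (tm_val e t2)"
| "tm_val e (App t1 t2) = app (tm_val e t1) (tm_val e t2)"

primrec holds :: "(nat \<Rightarrow> 'u::set_universe) \<Rightarrow> 'u fm \<Rightarrow> bool" where
  "holds e (Eq t1 t2) \<longleftrightarrow> tm_val e t1 = tm_val e t2"
| "holds e (Mem t1 t2) \<longleftrightarrow> tm_val e t1 \<epsilon> tm_val e t2"
| "holds e (Neg \<phi>) \<longleftrightarrow> \<not> holds e \<phi>"
| "holds e (Conj \<phi> \<psi>) \<longleftrightarrow> holds e \<phi> \<and> holds e \<psi>"
| "holds e (BAll v t \<phi>) \<longleftrightarrow> (\<forall>x. x \<epsilon> tm_val e t \<longrightarrow> holds (e(v := x)) \<phi>)"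

text \<open>
  Quantifiers being bounded, the truth of a statement does not depend on the superstructure in which
  it is interpreted; being closed, it does not depend on the environment.
\<close>

definition statement_in :: "'u::set_universe set \<Rightarrow> 'u fm \<Rightarrow> bool" where
  "statement_in S \<phi> \<longleftrightarrow> fm_constants \<phi> \<subseteq> superstr S \<and> free_vars \<phi> = {}"

definition true_fm :: "'u::set_universe fm \<Rightarrow> bool" where
  "true_fm \<phi> \<longleftrightarrow> (\<forall>e. holds e \<phi>)"

definition internal :: "'u::set_universe set \<Rightarrow> ('u \<Rightarrow> 'u) \<Rightarrow> 'u set" where
  "internal S star = (\<Union>A \<in> superstr S - S. elts (star A))"

text \<open>
  In the saturation clause, index sets of cardinality at most that of \<open>superstr S\<close> may be
  taken to consist of elements of the ambient universe.
\<close>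

definition enlargement :: "'u::set_universe set \<Rightarrow> 'u set \<Rightarrow> ('u \<Rightarrow> 'u) \<Rightarrow> bool" where
  "enlargement S W star \<longleftrightarrow>
     base_set S \<and> base_set W \<and> star \<in> superstr S \<rightarrow> superstr W \<and>
     star (code_set S) = code_set W \<and>
     (\<forall>s\<in>S. star s = s) \<and>
     (\<forall>\<phi>. statement_in S \<phi> \<longrightarrow> (true_fm \<phi> \<longleftrightarrow> true_fm (map_fm star \<phi>))) \<and>
     (\<forall>(J :: 'u set) U.
        J \<noteq> {} \<and> J \<lesssim> superstr S \<and>
        (\<forall>j\<in>J. U j \<in> internal S star \<and> is_set (U j) \<and> elts (U j) \<noteq> {}) \<and>
        (\<forall>F\<subseteq>J. finite F \<and> F \<noteq> {} \<longrightarrow> (\<Inter>j\<in>F. elts (U j)) \<noteq> {})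
        \<longrightarrow> (\<Inter>j\<in>J. elts (U j)) \<noteq> {})"


section \<open>Categories, functors, presheaves\<close>

text \<open>
  A category is given by its morphisms; \<open>src\<close> and \<open>tgt\<close> send a morphism to the identity of its source
  and target, and objects are identity morphisms. Only the values of \<open>src\<close>, \<open>tgt\<close> on \<open>Arr\<close> and of
  \<open>cmp\<close> on composable pairs matter.
\<close>

record 'm category_data =
  Arr :: "'m set"
  src :: "'m \<Rightarrow> 'm"
  tgt :: "'m \<Rightarrow> 'm"
  cmp :: "'m \<Rightarrow> 'm \<Rightarrow> 'm"

abbreviation cmp_syntax :: "'m \<Rightarrow> 'm category_data \<Rightarrow> 'm \<Rightarrow> 'm"  ("(_ \<odot>\<^bsub>_\<^esub>/ _)" [66, 0, 65] 65) where
  "f \<odot>\<^bsub>C\<^esub> g \<equiv> cmp C f g"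

definition Ob :: "'m category_data \<Rightarrow> 'm set" where
  "Ob C = {X \<in> Arr C. src C X = X}"

definition hom :: "'m category_data \<Rightarrow> 'm \<Rightarrow> 'm \<Rightarrow> 'm set" where
  "hom C X Y = {f \<in> Arr C. src C f = X \<and> tgt C f = Y}"

definition category :: "'m category_data \<Rightarrow> bool" where
  "category C \<longleftrightarrow>
     (\<forall>f\<in>Arr C. src C f \<in> Arr C \<and> tgt C f \<in> Arr C \<and>
        src C (src C f) = src C f \<and> tgt C (src C f) = src C f \<and>
        src C (tgt C f) = tgt C f \<and> tgt C (tgt C f) = tgt C f \<and>
        f \<odot>\<^bsub>C\<^esub> src C f = f \<and> tgt C f \<odot>\<^bsub>C\<^esub> f = f) \<and>
     (\<forall>f\<in>Arr C. \<forall>g\<in>Arr C. src C f = tgt C g \<longrightarrow>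
        f \<odot>\<^bsub>C\<^esub> g \<in> Arr C \<and> src C (f \<odot>\<^bsub>C\<^esub> g) = src C g \<and> tgt C (f \<odot>\<^bsub>C\<^esub> g) = tgt C f) \<and>
     (\<forall>f\<in>Arr C. \<forall>g\<in>Arr C. \<forall>h\<in>Arr C. src C f = tgt C g \<and> src C g = tgt C h \<longrightarrow>
        (f \<odot>\<^bsub>C\<^esub> g) \<odot>\<^bsub>C\<^esub> h = f \<odot>\<^bsub>C\<^esub> (g \<odot>\<^bsub>C\<^esub> h))"

definition opp :: "'m category_data \<Rightarrow> 'm category_data" where
  "opp C = \<lparr>Arr = Arr C, src = tgt C, tgt = src C, cmp = (\<lambda>f g. g \<odot>\<^bsub>C\<^esub> f)\<rparr>"

definition cofiltered :: "'m category_data \<Rightarrow> bool" where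
  "cofiltered I \<longleftrightarrow>
     Ob I \<noteq> {} \<and>
     (\<forall>i1\<in>Ob I. \<forall>i2\<in>Ob I. \<exists>j\<in>Ob I. hom I j i1 \<noteq> {} \<and> hom I j i2 \<noteq> {}) \<and>
     (\<forall>i\<in>Ob I. \<forall>i1\<in>Ob I. \<forall>i2\<in>Ob I. \<forall>f1\<in>hom I i1 i. \<forall>f2\<in>hom I i2 i.
        \<exists>j\<in>Ob I. \<exists>g1\<in>hom I j i1. \<exists>g2\<in>hom I j i2. f1 \<odot>\<^bsub>I\<^esub> g1 = f2 \<odot>\<^bsub>I\<^esub> g2) \<and>
     (\<forall>i1\<in>Ob I. \<forall>i2\<in>Ob I. \<forall>f1\<in>hom I i1 i2. \<forall>f2\<in>hom I i1 i2.
        \<exists>j\<in>Ob I. \<exists>g\<in>hom I j i1. f1 \<odot>\<^bsub>I\<^esub> g = f2 \<odot>\<^bsub>I\<^esub> g)"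

definition filtered :: "'m category_data \<Rightarrow> bool" where
  "filtered I \<longleftrightarrow> cofiltered (opp I)"

definition covariant_functor :: "'m category_data \<Rightarrow> 'n category_data \<Rightarrow> ('m \<Rightarrow> 'n) \<Rightarrow> bool" where
  "covariant_functor I C F \<longleftrightarrow>
     (\<forall>f\<in>Arr I. F f \<in> Arr C \<and> F (src I f) = src C (F f) \<and> F (tgt I f) = tgt C (F f)) \<and>
     (\<forall>f\<in>Arr I. \<forall>g\<in>Arr I. src I f = tgt I g \<longrightarrow> F (f \<odot>\<^bsub>I\<^esub> g) = F f \<odot>\<^bsub>C\<^esub> F g)"

record ('m, 'x) presheaf_data =
  Sec :: "'m \<Rightarrow> 'x set"
  Res :: "'m \<Rightarrow> 'x \<Rightarrow> 'x"

definition presheaf :: "'m category_data \<Rightarrow> ('m, 'x) presheaf_data \<Rightarrow> bool" where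
  "presheaf C P \<longleftrightarrow>
     (\<forall>f\<in>Arr C. \<forall>x\<in>Sec P (tgt C f). Res P f x \<in> Sec P (src C f)) \<and>
     (\<forall>X\<in>Ob C. \<forall>x\<in>Sec P X. Res P X x = x) \<and>
     (\<forall>f\<in>Arr C. \<forall>g\<in>Arr C. src C f = tgt C g \<longrightarrow>
        (\<forall>x\<in>Sec P (tgt C f). Res P (f \<odot>\<^bsub>C\<^esub> g) x = Res P g (Res P f x)))"

definition presheaf_morphism ::
  "'m category_data \<Rightarrow> ('m, 'x) presheaf_data \<Rightarrow> ('m, 'y) presheaf_data \<Rightarrow> ('m \<Rightarrow> 'x \<Rightarrow> 'y) \<Rightarrow> bool" where
  "presheaf_morphism C P Q \<tau> \<longleftrightarrow>
     presheaf C P \<and> presheaf C Q \<and>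
     (\<forall>X\<in>Ob C. \<forall>x\<in>Sec P X. \<tau> X x \<in> Sec Q X) \<and>
     (\<forall>f\<in>Arr C. \<forall>x\<in>Sec P (tgt C f). \<tau> (src C f) (Res P f x) = Res Q f (\<tau> (tgt C f) x))"

text \<open>
  The lemma \<open>presheaf_mono_iff_left_cancel\<close> below shows that this is the categorical notion.
\<close>

definition presheaf_mono ::
  "'m category_data \<Rightarrow> ('m, 'x) presheaf_data \<Rightarrow> ('m, 'y) presheaf_data \<Rightarrow> ('m \<Rightarrow> 'x \<Rightarrow> 'y) \<Rightarrow> bool" where
  "presheaf_mono C P Q \<tau> \<longleftrightarrow>
     presheaf_morphism C P Q \<tau> \<and> (\<forall>X\<in>Ob C. inj_on (\<tau> X) (Sec P X))"

definition presheaf_iso ::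
  "'m category_data \<Rightarrow> ('m, 'x) presheaf_data \<Rightarrow> ('m, 'y) presheaf_data \<Rightarrow> ('m \<Rightarrow> 'x \<Rightarrow> 'y) \<Rightarrow> bool" where
  "presheaf_iso C P Q \<tau> \<longleftrightarrow>
     presheaf_morphism C P Q \<tau> \<and>
     (\<exists>\<sigma>. presheaf_morphism C Q P \<sigma> \<and>
        (\<forall>X\<in>Ob C. \<forall>x\<in>Sec P X. \<sigma> X (\<tau> X x) = x) \<and>
        (\<forall>X\<in>Ob C. \<forall>y\<in>Sec Q X. \<tau> X (\<sigma> X y) = y))"

definition subpresheaf ::
  "'m category_data \<Rightarrow> ('m, 'x) presheaf_data \<Rightarrow> ('m, 'x) presheaf_data \<Rightarrow> bool" where
  "subpresheaf C P Q \<longleftrightarrow>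
     presheaf C P \<and> presheaf C Q \<and> (\<forall>X\<in>Ob C. Sec P X \<subseteq> Sec Q X) \<and>
     (\<forall>f\<in>Arr C. \<forall>x\<in>Sec P (tgt C f). Res P f x = Res Q f x)"

definition presheaf_equiv ::
  "'m category_data \<Rightarrow> ('m, 'x) presheaf_data \<Rightarrow> ('m \<Rightarrow> ('x \<times> 'x) set) \<Rightarrow> bool" where
  "presheaf_equiv C P R \<longleftrightarrow>
     (\<forall>X\<in>Ob C. equiv (Sec P X) (R X)) \<and>
     (\<forall>f\<in>Arr C. \<forall>(x, y)\<in>R (tgt C f). (Res P f x, Res P f y) \<in> R (src C f))"

definition quot_presheaf ::
  "'m category_data \<Rightarrow> ('m, 'x) presheaf_data \<Rightarrow> ('m \<Rightarrow> ('x \<times> 'x) set) \<Rightarrow> ('m, 'x set) presheaf_data" where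
  "quot_presheaf C P R =
     \<lparr>Sec = (\<lambda>X. Sec P X // R X), Res = (\<lambda>f A. R (src C f) `` (Res P f ` A))\<rparr>"

text \<open>The composite of a map into \<open>P\<close> with the projection from \<open>P\<close> to \<open>P/R\<close>.\<close>

definition to_quot :: "('m \<Rightarrow> ('x \<times> 'x) set) \<Rightarrow> ('m \<Rightarrow> 'z \<Rightarrow> 'x) \<Rightarrow> 'm \<Rightarrow> 'z \<Rightarrow> 'x set" where
  "to_quot R \<tau> X z = R X `` {\<tau> X z}"

text \<open>The map on equivalence classes induced by a map that is constant on them.\<close>

definition from_quot :: "('m \<Rightarrow> 'x \<Rightarrow> 'y) \<Rightarrow> 'm \<Rightarrow> 'x set \<Rightarrow> 'y" where
  "from_quot \<tau> X A = the_elem (\<tau> X ` A)"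

definition prod_presheaf :: "'i set \<Rightarrow> ('i \<Rightarrow> ('m, 'x) presheaf_data) \<Rightarrow> ('m, 'i \<Rightarrow> 'x) presheaf_data" where
  "prod_presheaf J P =
     \<lparr>Sec = (\<lambda>X. \<Pi>\<^sub>E i\<in>J. Sec (P i) X), Res = (\<lambda>f x. \<lambda>i\<in>J. Res (P i) f (x i))\<rparr>"

text \<open>\<open>hom_to C Y\<close> is a presheaf on \<open>C\<close>, and \<open>hom_from C Y\<close> is a presheaf on \<open>opp C\<close>.\<close>

definition hom_to :: "'m category_data \<Rightarrow> 'm \<Rightarrow> ('m, 'm) presheaf_data" where
  "hom_to C Y = \<lparr>Sec = (\<lambda>X. hom C X Y), Res = (\<lambda>f u. u \<odot>\<^bsub>C\<^esub> f)\<rparr>"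

definition hom_from :: "'m category_data \<Rightarrow> 'm \<Rightarrow> ('m, 'm) presheaf_data" where
  "hom_from C Y = \<lparr>Sec = (\<lambda>X. hom C Y X), Res = (\<lambda>f u. f \<odot>\<^bsub>C\<^esub> u)\<rparr>"

text \<open>
  The limit of the covariant functor from \<open>I\<close> to sets with values \<open>D i\<close> on objects and \<open>T f\<close> on
  morphisms.
\<close>

definition set_lim :: "'m category_data \<Rightarrow> ('m \<Rightarrow> 'x set) \<Rightarrow> ('m \<Rightarrow> 'x \<Rightarrow> 'x) \<Rightarrow> ('m \<Rightarrow> 'x) set" where
  "set_lim I D T = {x \<in> \<Pi>\<^sub>E i\<in>Ob I. D i. \<forall>f\<in>Arr I. T f (x (src I f)) = x (tgt I f)}"

definition lim_presheaf ::
  "'i category_data \<Rightarrow> 'm category_data \<Rightarrow> ('i \<Rightarrow> 'm) \<Rightarrow> ('m, 'i \<Rightarrow> 'm) presheaf_data" where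
  "lim_presheaf I C F =
     \<lparr>Sec = (\<lambda>X. set_lim I (\<lambda>i. hom C X (F i)) (\<lambda>f u. F f \<odot>\<^bsub>C\<^esub> u)),
      Res = (\<lambda>h x. \<lambda>i\<in>Ob I. x i \<odot>\<^bsub>C\<^esub> h)\<rparr>"

definition colim_presheaf ::
  "'i category_data \<Rightarrow> 'm category_data \<Rightarrow> ('i \<Rightarrow> 'm) \<Rightarrow> ('m, 'i \<Rightarrow> 'm) presheaf_data" where
  "colim_presheaf I C F =
     \<lparr>Sec = (\<lambda>X. set_lim (opp I) (\<lambda>i. hom C (F i) X) (\<lambda>f u. u \<odot>\<^bsub>C\<^esub> F f)),
      Res = (\<lambda>h x. \<lambda>i\<in>Ob I. h \<odot>\<^bsub>C\<^esub> x i)\<rparr>"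

lemma presheaf_mono_iff_left_cancel:
  fixes C :: "'m category_data" and P :: "('m, 'x) presheaf_data" and Q :: "('m, 'y) presheaf_data"
  assumes C: "category C"
  shows "presheaf_mono C P Q \<tau> \<longleftrightarrow>
    presheaf_morphism C P Q \<tau> \<and>
    (\<forall>(R :: ('m, 'm) presheaf_data) \<alpha> \<beta>.
       presheaf_morphism C R P \<alpha> \<and> presheaf_morphism C R P \<beta> \<and>
       (\<forall>X\<in>Ob C. \<forall>r\<in>Sec R X. \<tau> X (\<alpha> X r) = \<tau> X (\<beta> X r))
       \<longrightarrow> (\<forall>X\<in>Ob C. \<forall>r\<in>Sec R X. \<alpha> X r = \<beta> X r))"
    (is "_ \<longleftrightarrow> _ \<and> ?cancel")
proof (intro iffI conjI)
  assume "presheaf_mono C P Q \<tau>"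
  then show "presheaf_morphism C P Q \<tau>" and ?cancel
    unfolding presheaf_mono_def presheaf_morphism_def inj_on_def by blast+
next
  assume *: "presheaf_morphism C P Q \<tau> \<and> ?cancel"
  then have P: "presheaf C P" by (simp add: presheaf_morphism_def)
  have "x = y" if X: "X \<in> Ob C" and x: "x \<in> Sec P X" and y: "y \<in> Sec P X" and eq: "\<tau> X x = \<tau> X y"
    for X x y
  proof -
    define mor where "mor z = (\<lambda>(Z::'m) h. Res P h z)" for z
    have R: "presheaf C (hom_to C X)"
      using C unfolding presheaf_def hom_to_def hom_def category_def Ob_def by simp metis
    have mor: "presheaf_morphism C (hom_to C X) P (mor z)" if "z \<in> Sec P X" for z
      using R P C that unfolding presheaf_morphism_def mor_def
      by (auto simp: presheaf_def hom_to_def hom_def category_def Ob_def)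
    have "\<tau> Z (mor x Z h) = \<tau> Z (mor y Z h)" if "Z \<in> Ob C" "h \<in> Sec (hom_to C X) Z" for Z h
    proof -
      have h: "h \<in> Arr C" "src C h = Z" "tgt C h = X"
        using that by (auto simp: hom_to_def hom_def)
      moreover have "\<forall>f\<in>Arr C. \<forall>x\<in>Sec P (tgt C f). \<tau> (src C f) (Res P f x) = Res Q f (\<tau> (tgt C f) x)"
        using * by (simp add: presheaf_morphism_def)
      ultimately show ?thesis
        using x y eq unfolding mor_def by metis
    qed
    then have "\<forall>Z\<in>Ob C. \<forall>h\<in>Sec (hom_to C X) Z. mor x Z h = mor y Z h"
      using * mor[OF x] mor[OF y] by blast
    moreover have "X \<in> Sec (hom_to C X) X"
      using X C by (auto simp: Ob_def hom_to_def hom_def category_def)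
    ultimately have "Res P X x = Res P X y"
      using X by (auto simp: mor_def)
    then show ?thesis using P X x y by (simp add: presheaf_def)
  qed
  then show "presheaf_mono C P Q \<tau>"
    using * by (auto simp: presheaf_mono_def inj_on_def)
qed


section \<open>Small categories and functors, and their enlargements\<close>

record 'u small_cat =
  s_mor :: 'u
  s_src :: 'u
  s_tgt :: 'u
  s_cmp :: 'u

definition cat :: "'u::set_universe small_cat \<Rightarrow> 'u category_data" where
  "cat K = \<lparr>Arr = elts (s_mor K), src = app (s_src K), tgt = app (s_tgt K),
            cmp = (\<lambda>f g. THE h. otriple f g h \<epsilon> s_cmp K)\<rparr>"

definition small_category :: "'u::set_universe set \<Rightarrow> 'u small_cat \<Rightarrow> bool" where
  "small_category S K \<longleftrightarrow>
     s_mor K \<in> superstr S - S \<and> category (cat K) \<and>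
     is_set (s_src K) \<and> elts (s_src K) = {opair f (src (cat K) f) | f. f \<in> Arr (cat K)} \<and>
     is_set (s_tgt K) \<and> elts (s_tgt K) = {opair f (tgt (cat K) f) | f. f \<in> Arr (cat K)} \<and>
     is_set (s_cmp K) \<and> elts (s_cmp K) = {otriple f g (f \<odot>\<^bsub>cat K\<^esub> g) | f g.
        f \<in> Arr (cat K) \<and> g \<in> Arr (cat K) \<and> src (cat K) f = tgt (cat K) g}"

definition small_functor :: "'u::set_universe small_cat \<Rightarrow> 'u small_cat \<Rightarrow> 'u \<Rightarrow> bool" where
  "small_functor I C G \<longleftrightarrow>
     is_set G \<and> elts G = {opair f (app G f) | f. f \<in> Arr (cat I)} \<and>
     covariant_functor (cat I) (cat C) (app G)"

definition enl :: "('u::set_universe \<Rightarrow> 'u) \<Rightarrow> 'u small_cat \<Rightarrow> 'u category_data" where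
  "enl star K = cat \<lparr>s_mor = star (s_mor K), s_src = star (s_src K),
                     s_tgt = star (s_tgt K), s_cmp = star (s_cmp K)\<rparr>"

definition star_pullback :: "('u \<Rightarrow> 'u) \<Rightarrow> ('u, 'x) presheaf_data \<Rightarrow> ('u, 'x) presheaf_data" where
  "star_pullback star P = \<lparr>Sec = (\<lambda>X. Sec P (star X)), Res = (\<lambda>f. Res P (star f))\<rparr>"


section \<open>Limits and colimits via an enlargement\<close>

definition lim_tilde ::
  "('u::set_universe \<Rightarrow> 'u) \<Rightarrow> 'u small_cat \<Rightarrow> 'u \<Rightarrow> 'u \<Rightarrow> ('u, 'u) presheaf_data" where
  "lim_tilde star C G i0 = star_pullback star (hom_to (enl star C) (app (star G) i0))"

definition lim_fin :: "('u::set_universe \<Rightarrow> 'u) \<Rightarrow> 'u small_cat \<Rightarrow> 'u small_cat \<Rightarrow> 'u \<Rightarrow> 'u \<Rightarrow>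
    ('u \<Rightarrow> 'u) \<Rightarrow> ('u, 'u) presheaf_data" where
  "lim_fin star I C G i0 p =
     \<lparr>Sec = (\<lambda>X. {\<phi> \<in> Sec (lim_tilde star C G i0) X.
               \<forall>i\<in>Ob (cat I). \<exists>u\<in>hom (cat C) X (app G i).
                 app (star G) (p i) \<odot>\<^bsub>enl star C\<^esub> \<phi> = star u}),
      Res = Res (lim_tilde star C G i0)\<rparr>"

definition lim_components :: "('u::set_universe \<Rightarrow> 'u) \<Rightarrow> 'u small_cat \<Rightarrow> 'u small_cat \<Rightarrow> 'u \<Rightarrow>
    ('u \<Rightarrow> 'u) \<Rightarrow> 'u \<Rightarrow> 'u \<Rightarrow> 'u \<Rightarrow> 'u" where
  "lim_components star I C G p X \<phi> = (\<lambda>i\<in>Ob (cat I). app (star G) (p i) \<odot>\<^bsub>enl star C\<^esub> \<phi>)"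

definition lim_sim :: "('u::set_universe \<Rightarrow> 'u) \<Rightarrow> 'u small_cat \<Rightarrow> 'u small_cat \<Rightarrow> 'u \<Rightarrow> 'u \<Rightarrow>
    ('u \<Rightarrow> 'u) \<Rightarrow> 'u \<Rightarrow> ('u \<times> 'u) set" where
  "lim_sim star I C G i0 p X =
     {(\<phi>, \<psi>). \<phi> \<in> Sec (lim_fin star I C G i0 p) X \<and> \<psi> \<in> Sec (lim_fin star I C G i0 p) X \<and>
        (\<forall>i\<in>Ob (cat I). app (star G) (p i) \<odot>\<^bsub>enl star C\<^esub> \<phi> = app (star G) (p i) \<odot>\<^bsub>enl star C\<^esub> \<psi>)}"

definition colim_tilde ::
  "('u::set_universe \<Rightarrow> 'u) \<Rightarrow> 'u small_cat \<Rightarrow> 'u \<Rightarrow> 'u \<Rightarrow> ('u, 'u) presheaf_data" where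
  "colim_tilde star C G i0 = star_pullback star (hom_from (enl star C) (app (star G) i0))"

definition colim_fin :: "('u::set_universe \<Rightarrow> 'u) \<Rightarrow> 'u small_cat \<Rightarrow> 'u small_cat \<Rightarrow> 'u \<Rightarrow> 'u \<Rightarrow>
    ('u \<Rightarrow> 'u) \<Rightarrow> ('u, 'u) presheaf_data" where
  "colim_fin star I C G i0 q =
     \<lparr>Sec = (\<lambda>X. {\<phi> \<in> Sec (colim_tilde star C G i0) X.
               \<forall>i\<in>Ob (cat I). \<exists>u\<in>hom (cat C) (app G i) X.
                 \<phi> \<odot>\<^bsub>enl star C\<^esub> app (star G) (q i) = star u}),
      Res = Res (colim_tilde star C G i0)\<rparr>"

definition colim_components :: "('u::set_universe \<Rightarrow> 'u) \<Rightarrow> 'u small_cat \<Rightarrow> 'u small_cat \<Rightarrow> 'u \<Rightarrow>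
    ('u \<Rightarrow> 'u) \<Rightarrow> 'u \<Rightarrow> 'u \<Rightarrow> 'u \<Rightarrow> 'u" where
  "colim_components star I C G q X \<phi> = (\<lambda>i\<in>Ob (cat I). \<phi> \<odot>\<^bsub>enl star C\<^esub> app (star G) (q i))"

definition colim_sim :: "('u::set_universe \<Rightarrow> 'u) \<Rightarrow> 'u small_cat \<Rightarrow> 'u small_cat \<Rightarrow> 'u \<Rightarrow> 'u \<Rightarrow>
    ('u \<Rightarrow> 'u) \<Rightarrow> 'u \<Rightarrow> ('u \<times> 'u) set" where
  "colim_sim star I C G i0 q X =
     {(\<phi>, \<psi>). \<phi> \<in> Sec (colim_fin star I C G i0 q) X \<and> \<psi> \<in> Sec (colim_fin star I C G i0 q) X \<and>
        (\<forall>i\<in>Ob (cat I). \<phi> \<odot>\<^bsub>enl star C\<^esub> app (star G) (q i) = \<psi> \<odot>\<^bsub>enl star C\<^esub> app (star G) (q i))}"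

text \<open>
  The canonical map out of the limit (and, dually, out of the colimit) presheaf: a compatible family
  \<open>x\<close> is a function on the objects of \<open>I\<close> belonging to the superstructure, so its enlargement
  is a function on the objects of the enlarged index category, which can be evaluated at \<open>i0\<close>.
\<close>

definition canonical :: "('u::set_universe \<Rightarrow> 'u) \<Rightarrow> 'u small_cat \<Rightarrow> 'u \<Rightarrow> 'u \<Rightarrow> ('u \<Rightarrow> 'u) \<Rightarrow> 'u" where
  "canonical star I i0 X x = app (star (graph (Ob (cat I)) x)) i0"

definition projections :: "'u::set_universe small_cat \<Rightarrow> 'u \<Rightarrow> ('u \<Rightarrow> 'u) \<Rightarrow> 'u \<Rightarrow> 'u" where
  "projections I X x = (\<lambda>i\<in>Ob (cat I). x i)"

definition star_family :: "('u::set_universe \<Rightarrow> 'u) \<Rightarrow> 'u small_cat \<Rightarrow> 'u \<Rightarrow> ('u \<Rightarrow> 'u) \<Rightarrow> 'u \<Rightarrow> 'u" where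
  "star_family star I X u = (\<lambda>i\<in>Ob (cat I). star (u i))"

end

theory Submission
  imports Defs
begin

text \<open>
  A compatible family \<open>x\<close> in \<open>lim Mor(X, G i)\<close> is a function on the objects of \<open>I\<close>, and its graph
  belongs to the superstructure. By transfer, its enlargement \<open>*x\<close> is a compatible family indexed by
  the objects of \<open>*I\<close>: for every object \<open>i\<close> of \<open>*I\<close>, standard or not, \<open>*x(i)\<close> is a morphism from
  \<open>*X\<close> to \<open>*G(i)\<close>, and \<open>*G(f) *x(i) = *x(j)\<close> for every \<open>f : i \<rightarrow> j\<close> in \<open>*I\<close>. The canonical map
  sends \<open>x\<close> to \<open>*x(i0)\<close>. Taking for \<open>f\<close> the morphism \<open>p i : i0 \<rightarrow> *i\<close> of the cone gives

    \<open>*G(p i) *x(i0) = *x(*i) = *(x i)\<close>,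

  so that the canonical map has values in the finite part, with \<open>x i\<close> as standard components
  (lemmas \<open>canonical_hom\<close>, \<open>canonical_transition\<close>, \<open>canonical_star\<close>, \<open>components_\<kappa>\<close>). Since \<open>*\<close> is
  injective, \<open>x\<close> is recovered from these components (\<open>\<mu>_\<kappa>_inj\<close>). Conversely, the standard components
  of a member of the finite part are compatible, because \<open>*f \<circ> p i = p j\<close> for \<open>f : i \<rightarrow> j\<close> in \<open>I\<close>
  and because \<open>*\<close> is faithful; hence each of its classes comes from the limit (\<open>\<mu>_\<kappa>_surj\<close>).
  As \<open>\<sim>\<close> is the kernel of the components map \<open>\<mu>\<close>, the isomorphism with the quotient, the
  monomorphism into the product and the commutative square are formal consequences, stated for
  arbitrary kernels in \<open>to_quot_kernel_iso\<close> and \<open>from_quot_kernel_mono\<close>. If \<open>Mor(X, G i)\<close> is finite,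
  then \<open>*\<close> maps it onto \<open>Mor(*X, *G(*i))\<close>, since a finite set gains no elements under enlargement
  (\<open>hom_enl_finite\<close>); so every section lies in the finite part.

  The second half is the first one for the opposite categories. The opposite of a small category is a
  small category, and transfer shows that its enlargement is the opposite of the enlargement
  (\<open>enl_op_small\<close>).

  For transfer, composition has to be a term of the formal language: on composable pairs it is the
  application of the composition relation, seen as a function of the ordered pair \<open>(f, g)\<close>
  (\<open>app_s_cmp\<close>, \<open>cmp_enl\<close>).
\<close>


section \<open>Finite sets, ordered pairs and superstructures\<close>

lemma code_set_eqI:
  assumes "is_set y" and "elts y = A"
  shows "code_set A = y"
  unfolding code_set_def
  using assms by (intro the_equality) (auto simp: elts_def intro: set_ext)

lemma code_set_finite:
  fixes A :: "'u::set_universe set"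
  assumes "finite A"
  shows is_set_code_set_finite: "is_set (code_set A)"
    and elts_code_set_finite: "elts (code_set A) = A"
proof -
  obtain y where "is_set y" "\<forall>z. z \<epsilon> y \<longleftrightarrow> z \<in> A"
    using finite_set_ex[OF assms] by blast
  then have y: "is_set y" "elts y = A"
    by (auto simp: elts_def)
  then have "code_set A = y"
    by (rule code_set_eqI)
  with y show "is_set (code_set A)" "elts (code_set A) = A"
    by auto
qed

lemma code_set_inject:
  fixes A B :: "'u::set_universe set"
  assumes "finite A" and "finite B"
  shows "code_set A = code_set B \<longleftrightarrow> A = B"
  using elts_code_set_finite[OF assms(1)] elts_code_set_finite[OF assms(2)] by metis

lemma opair_inject [simp]:
  fixes a b c d :: "'u::set_universe"
  shows "opair a b = opair c d \<longleftrightarrow> a = c \<and> b = d"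
  by (auto simp: opair_def code_set_inject doubleton_eq_iff)

lemma app_eqI:
  assumes "opair x y \<epsilon> f" and "\<And>z. opair x z \<epsilon> f \<Longrightarrow> z = y"
  shows "app f x = y"
proof -
  have "\<exists>!y. opair x y \<epsilon> f" and "(THE y. opair x y \<epsilon> f) = y"
    using assms by blast+
  then show ?thesis
    by (simp add: app_def)
qed

lemma level_mono: "m \<le> n \<Longrightarrow> level S m \<subseteq> level S n"
  by (rule lift_Suc_mono_le) auto

lemma superstr_set:
  fixes S :: "'u::set_universe set"
  assumes "is_set y" and "elts y \<subseteq> level S n"
  shows "y \<in> superstr S"
proof -
  have "y \<in> level S (Suc n)"
    using assms by simp
  then show ?thesis
    unfolding superstr_def by blast
qed

lemma opair_level:
  fixes S :: "'u::set_universe set"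
  assumes "a \<in> level S n" and "b \<in> level S n"
  shows "opair a b \<in> level S (Suc (Suc n))"
  using assms by (simp add: opair_def code_set_finite)

lemma opair_superstr:
  fixes S :: "'u::set_universe set"
  assumes "a \<in> superstr S" and "b \<in> superstr S"
  shows "opair a b \<in> superstr S"
proof -
  obtain m n where "a \<in> level S m" "b \<in> level S n"
    using assms by (auto simp: superstr_def)
  then have "a \<in> level S (max m n)" "b \<in> level S (max m n)"
    using level_mono[of m "max m n" S] level_mono[of n "max m n" S] by auto
  then show ?thesis
    using opair_level unfolding superstr_def by blast
qed

lemma elts_level:
  fixes S :: "'u::set_universe set"
  assumes "base_set S" and "y \<in> superstr S"
  obtains n where "elts y \<subseteq> level S n"
proof -
  have "\<exists>n. elts y \<subseteq> level S n" if "y \<in> level S m" for m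
    using that
  proof (induction m)
    case 0
    then have "\<not> is_set y"
      using assms by (auto simp: base_set_def)
    then have "elts y = {}"
      by (auto simp: elts_def dest: mem_is_set)
    then show ?case by simp
  next
    case (Suc m)
    then show ?case by auto
  qed
  with assms(2) that show thesis
    by (auto simp: superstr_def)
qed

lemma mem_superstr:
  assumes "base_set S" and "y \<in> superstr S" and "x \<epsilon> y"
  shows "x \<in> superstr S"
proof -
  obtain n where "elts y \<subseteq> level S n"
    using elts_level[OF assms(1,2)] .
  with assms(3) show ?thesis
    unfolding superstr_def elts_def by blast
qed

text \<open>A relation between two members of the superstructure is bounded in rank, hence itself a member.\<close>

lemma relation_superstr:
  fixes S :: "'u::set_universe set"
  assumes S: "base_set S" and A: "A \<in> superstr S" and B: "B \<in> superstr S"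
    and R: "R \<subseteq> {opair a b | a b. a \<in> elts A \<and> b \<in> elts B}"
  shows "\<exists>n. R \<subseteq> level S n"
proof -
  obtain m n where "elts A \<subseteq> level S m" "elts B \<subseteq> level S n"
    using elts_level[OF S A] elts_level[OF S B] by metis
  then have "elts A \<subseteq> level S (max m n)" "elts B \<subseteq> level S (max m n)"
    using level_mono[of m "max m n" S] level_mono[of n "max m n" S] by auto
  then have "R \<subseteq> level S (Suc (Suc (max m n)))"
    using R opair_level[of _ S "max m n"] by blast
  then show ?thesis by blast
qed

lemma relation_mem_superstr:
  fixes S :: "'u::set_universe set"
  assumes "base_set S" "A \<in> superstr S" "B \<in> superstr S" "is_set y"
    and "elts y \<subseteq> {opair a b | a b. a \<in> elts A \<and> b \<in> elts B}"
  shows "y \<in> superstr S"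
  using relation_superstr[OF assms(1-3,5)] superstr_set[OF assms(4)] by blast

lemma relation_code_set:
  fixes S :: "'u::set_universe set"
  assumes "base_set S" "A \<in> superstr S" "B \<in> superstr S"
    and "R \<subseteq> {opair a b | a b. a \<in> elts A \<and> b \<in> elts B}"
  shows relation_code_set_superstr: "code_set R \<in> superstr S"
    and elts_relation_code_set: "elts (code_set R) = R"
    and is_set_relation_code_set: "is_set (code_set R)"
proof -
  obtain n where n: "R \<subseteq> level S n"
    using relation_superstr[OF assms] by blast
  then obtain y where y: "is_set y" "elts y = R"
    using assms(1) unfolding base_set_def by blast
  then have "code_set R = y"
    by (rule code_set_eqI)
  with y n show "code_set R \<in> superstr S" "elts (code_set R) = R" "is_set (code_set R)"
    using superstr_set by auto
qed

lemma product_ex: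
  fixes S :: "'u::set_universe set"
  assumes "base_set S" "A \<in> superstr S" "B \<in> superstr S"
  obtains P where "P \<in> superstr S" "elts P = {opair a b | a b. a \<in> elts A \<and> b \<in> elts B}"
  using relation_code_set[OF assms subset_refl] by blast

lemma graph_props:
  fixes S :: "'u::set_universe set"
  assumes S: "base_set S" and A: "A \<in> superstr S" and B: "B \<in> superstr S"
    and D: "D \<subseteq> elts A" and x: "\<And>i. i \<in> D \<Longrightarrow> x i \<in> elts B"
  shows graph_superstr: "graph D x \<in> superstr S"
    and app_graph: "i \<in> D \<Longrightarrow> app (graph D x) i = x i"
proof -
  have R: "(\<lambda>i. opair i (x i)) ` D \<subseteq> {opair a b | a b. a \<in> elts A \<and> b \<in> elts B}"
    using D x by blast
  show "graph D x \<in> superstr S"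
    unfolding graph_def by (rule relation_code_set_superstr[OF S A B R])
  have "z \<epsilon> graph D x \<longleftrightarrow> z \<in> (\<lambda>i. opair i (x i)) ` D" for z
    using elts_relation_code_set[OF S A B R] by (auto simp: graph_def elts_def)
  then show "app (graph D x) i = x i" if "i \<in> D"
    using that by (intro app_eqI) auto
qed


section \<open>Transfer\<close>

text \<open>
  In what follows each property is transferred by writing it as an explicit closed formula; evaluating
  \<open>holds\<close> on the formula and on its image under \<open>map_fm star\<close> yields the two versions.
\<close>

abbreviation Impl :: "'u fm \<Rightarrow> 'u fm \<Rightarrow> 'u fm" where
  "Impl \<phi> \<psi> \<equiv> Neg (Conj \<phi> (Neg \<psi>))"

abbreviation BEx :: "nat \<Rightarrow> 'u tm \<Rightarrow> 'u fm \<Rightarrow> 'u fm" where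
  "BEx v t \<phi> \<equiv> Neg (BAll v t (Neg \<phi>))"

locale enlarging =
  fixes S W :: "'u::set_universe set" and star :: "'u \<Rightarrow> 'u"
  assumes enlargement: "enlargement S W star"
begin

lemma base_set_S: "base_set S"
  using enlargement by (simp add: enlargement_def)

lemma transfer:
  assumes "fm_constants \<phi> \<subseteq> superstr S" and "free_vars \<phi> = {}"
  shows "(\<forall>e. holds e \<phi>) \<longleftrightarrow> (\<forall>e. holds e (map_fm star \<phi>))"
  using enlargement assms unfolding enlargement_def statement_in_def true_fm_def by blast

lemma transfer_holds:
  assumes "\<And>e. holds e \<phi>" and "fm_constants \<phi> \<subseteq> superstr S" and "free_vars \<phi> = {}"
  shows "holds e (map_fm star \<phi>)"
  using transfer[OF assms(2,3)] assms(1) by blast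

lemma star_eq_iff:
  assumes "a \<in> superstr S" "b \<in> superstr S"
  shows "star a = star b \<longleftrightarrow> a = b"
  using transfer[of "Eq (Cst a) (Cst b)"] assms by simp

lemma star_mem_iff:
  assumes "a \<in> superstr S" "b \<in> superstr S"
  shows "star a \<epsilon> star b \<longleftrightarrow> a \<epsilon> b"
  using transfer[of "Mem (Cst a) (Cst b)"] assms by simp

lemma star_opair:
  assumes "a \<in> superstr S" "b \<in> superstr S"
  shows "star (opair a b) = opair (star a) (star b)"
  using transfer[of "Eq (Cst (opair a b)) (Tup (Cst a) (Cst b))"] assms opair_superstr[OF assms] by simp

lemma star_app:
  assumes "f \<in> superstr S" "a \<in> superstr S" "app f a \<in> superstr S"
  shows "star (app f a) = app (star f) (star a)"
  using transfer[of "Eq (Cst (app f a)) (App (Cst f) (Cst a))"] assms by simp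

lemma code_set_finite_superstr:
  assumes "finite A" "A \<subseteq> superstr S"
  shows "code_set A \<in> superstr S"
proof -
  have "\<exists>n. A \<subseteq> level S n"
    using assms
  proof (induction A)
    case (insert a A)
    then obtain m n where "a \<in> level S m" "A \<subseteq> level S n"
      by (auto simp: superstr_def)
    then have "insert a A \<subseteq> level S (max m n)"
      using level_mono[of m "max m n" S] level_mono[of n "max m n" S] by auto
    then show ?case by blast
  qed simp
  then show ?thesis
    using superstr_set code_set_finite[OF assms(1)] by metis
qed

text \<open>A finite set of the superstructure acquires no new elements under enlargement.\<close>

lemma elts_star_finite:
  assumes "finite A" "A \<subseteq> superstr S"
  shows "elts (star (code_set A)) = star ` A"
  using assms
proof (induction A)
  case empty
  have "\<forall>z. \<not> z \<epsilon> star (code_set {})"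
    using transfer[of "BAll 0 (Cst (code_set {})) (Neg (Eq (Var 0) (Var 0)))"]
      code_set_finite_superstr[of "{}"] elts_code_set_finite[of "{} :: 'u set"]
    by (simp add: elts_def)
  then show ?case
    by (simp add: elts_def)
next
  case (insert a A)
  let ?B = "code_set (insert a A)"
  have A: "finite A" "A \<subseteq> superstr S" "a \<in> superstr S"
    using insert by auto
  have const: "?B \<in> superstr S" "code_set A \<in> superstr S"
    using code_set_finite_superstr A by auto
  have mem: "z \<epsilon> ?B \<longleftrightarrow> z = a \<or> z \<epsilon> code_set A" for z
    using elts_code_set_finite[of "insert a A"] elts_code_set_finite[of A] A
    by (auto simp: elts_def)
  have "\<forall>z. z \<epsilon> star ?B \<longrightarrow> z \<noteq> star a \<longrightarrow> z \<epsilon> star (code_set A)"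
    using transfer[of "BAll 0 (Cst ?B) (Impl (Neg (Eq (Var 0) (Cst a))) (Mem (Var 0) (Cst (code_set A))))"]
      const A mem by auto
  moreover have "\<forall>z. z \<epsilon> star (code_set A) \<longrightarrow> z \<epsilon> star ?B"
    using transfer[of "BAll 0 (Cst (code_set A)) (Mem (Var 0) (Cst ?B))"] const mem by simp
  moreover have "star a \<epsilon> star ?B"
    using star_mem_iff const A mem by simp
  ultimately have "elts (star ?B) = insert (star a) (elts (star (code_set A)))"
    by (auto simp: elts_def)
  then show ?case
    using insert by simp
qed

end


section \<open>Categories and presheaves\<close>

lemma category_arr:
  assumes "category C" "f \<in> Arr C"
  shows "src C f \<in> Arr C" "tgt C f \<in> Arr C"
    "src C (src C f) = src C f" "tgt C (src C f) = src C f"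
    "src C (tgt C f) = tgt C f" "tgt C (tgt C f) = tgt C f"
    "f \<odot>\<^bsub>C\<^esub> src C f = f" "tgt C f \<odot>\<^bsub>C\<^esub> f = f"
  using assms unfolding category_def by blast+

lemma category_comp:
  assumes "category C" "f \<in> Arr C" "g \<in> Arr C" "src C f = tgt C g"
  shows "f \<odot>\<^bsub>C\<^esub> g \<in> Arr C" "src C (f \<odot>\<^bsub>C\<^esub> g) = src C g" "tgt C (f \<odot>\<^bsub>C\<^esub> g) = tgt C f"
  using assms unfolding category_def by blast+

lemma category_assoc:
  assumes "category C" "f \<in> Arr C" "g \<in> Arr C" "h \<in> Arr C"
    and "src C f = tgt C g" "src C g = tgt C h"
  shows "(f \<odot>\<^bsub>C\<^esub> g) \<odot>\<^bsub>C\<^esub> h = f \<odot>\<^bsub>C\<^esub> (g \<odot>\<^bsub>C\<^esub> h)"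
  using assms unfolding category_def by blast

lemma Ob_arr:
  assumes "category C" "X \<in> Ob C"
  shows "X \<in> Arr C" "src C X = X" "tgt C X = X"
  using assms category_arr(4)[of C X] by (auto simp: Ob_def)

lemma src_tgt_Ob:
  assumes "category C" "f \<in> Arr C"
  shows "src C f \<in> Ob C" "tgt C f \<in> Ob C"
  using category_arr[OF assms] by (auto simp: Ob_def)

lemma presheaf_isoI:
  assumes \<tau>: "presheaf_morphism C P Q \<tau>"
    and bij: "\<And>X. X \<in> Ob C \<Longrightarrow> bij_betw (\<tau> X) (Sec P X) (Sec Q X)"
    and C: "category C"
  shows "presheaf_iso C P Q \<tau>"
proof -
  define \<sigma> where "\<sigma> X = inv_into (Sec P X) (\<tau> X)" for X
  note ob = src_tgt_Ob[OF C]
  have P: "presheaf C P" and Q: "presheaf C Q"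
    using \<tau> by (auto simp: presheaf_morphism_def)
  have \<sigma>: "\<sigma> X y \<in> Sec P X" "\<tau> X (\<sigma> X y) = y" if "X \<in> Ob C" "y \<in> Sec Q X" for X y
    using bij[OF that(1)] that(2) unfolding \<sigma>_def bij_betw_def
    by (auto intro: inv_into_into f_inv_into_f)
  have \<sigma>\<tau>: "\<sigma> X (\<tau> X x) = x" if "X \<in> Ob C" "x \<in> Sec P X" for X x
    using bij[OF that(1)] that(2) unfolding \<sigma>_def bij_betw_def by (simp add: inv_into_f_f)
  have "\<sigma> (src C f) (Res Q f y) = Res P f (\<sigma> (tgt C f) y)"
    if f: "f \<in> Arr C" and y: "y \<in> Sec Q (tgt C f)" for f y
  proof -
    note s = \<sigma>[OF ob(2)[OF f] y]
    have "Res Q f y = \<tau> (src C f) (Res P f (\<sigma> (tgt C f) y))"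
      using \<tau> f s by (auto simp: presheaf_morphism_def)
    moreover have "Res P f (\<sigma> (tgt C f) y) \<in> Sec P (src C f)"
      using P f s(1) by (simp add: presheaf_def)
    ultimately show ?thesis
      using \<sigma>\<tau>[OF ob(1)[OF f]] by simp
  qed
  then have "presheaf_morphism C Q P \<sigma>"
    using P Q \<sigma>(1) by (simp add: presheaf_morphism_def)
  then show ?thesis
    unfolding presheaf_iso_def using \<tau> \<sigma>(2) \<sigma>\<tau> by blast
qed

text \<open>The equivalence relation on the sections of \<open>P\<close> of having the same image under \<open>\<mu>\<close>.\<close>

definition kernel :: "('m, 'x) presheaf_data \<Rightarrow> ('m \<Rightarrow> 'x \<Rightarrow> 'y) \<Rightarrow> 'm \<Rightarrow> ('x \<times> 'x) set" where
  "kernel P \<mu> X = {(x, y). x \<in> Sec P X \<and> y \<in> Sec P X \<and> \<mu> X x = \<mu> X y}"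

lemma equiv_kernel: "equiv (Sec P X) (kernel P \<mu> X)"
  by (rule equivI) (auto simp: kernel_def refl_on_def sym_def trans_def)

lemma kernel_class: "x \<in> Sec P X \<Longrightarrow> kernel P \<mu> X `` {x} = {y \<in> Sec P X. \<mu> X y = \<mu> X x}"
  by (auto simp: kernel_def)

lemma from_quot_kernel:
  assumes "x \<in> Sec P X"
  shows "from_quot \<mu> X (kernel P \<mu> X `` {x}) = \<mu> X x"
proof -
  have "\<mu> X ` (kernel P \<mu> X `` {x}) = {\<mu> X x}"
    using assms by (auto simp: kernel_class)
  then show ?thesis
    by (simp add: from_quot_def)
qed

lemma Sec_quot_kernel:
  "Sec (quot_presheaf C P (kernel P \<mu>)) X = (\<lambda>x. kernel P \<mu> X `` {x}) ` Sec P X"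
  by (auto simp: quot_presheaf_def quotient_def)

lemma kernel_class_eq_iff:
  assumes "x \<in> Sec P X" "y \<in> Sec P X"
  shows "kernel P \<mu> X `` {x} = kernel P \<mu> X `` {y} \<longleftrightarrow> \<mu> X x = \<mu> X y"
  using assms by (auto simp: kernel_class)

lemma presheaf_equiv_kernel:
  assumes "presheaf_morphism C P Q \<mu>"
  shows "presheaf_equiv C P (kernel P \<mu>)"
proof -
  have "(Res P f x, Res P f y) \<in> kernel P \<mu> (src C f)"
    if "f \<in> Arr C" "(x, y) \<in> kernel P \<mu> (tgt C f)" for f x y
    using assms that by (simp add: kernel_def presheaf_morphism_def presheaf_def)
  then show ?thesis
    unfolding presheaf_equiv_def by (auto simp: equiv_kernel)
qed

lemma Res_quot_kernel:
  assumes \<mu>: "presheaf_morphism C P Q \<mu>" and f: "f \<in> Arr C" and x: "x \<in> Sec P (tgt C f)"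
  shows "Res (quot_presheaf C P (kernel P \<mu>)) f (kernel P \<mu> (tgt C f) `` {x}) =
    kernel P \<mu> (src C f) `` {Res P f x}"
proof -
  have "kernel P \<mu> (src C f) `` {Res P f y} = kernel P \<mu> (src C f) `` {Res P f x}"
    if y: "y \<in> Sec P (tgt C f)" "\<mu> (tgt C f) y = \<mu> (tgt C f) x" for y
  proof -
    have "Res P f x \<in> Sec P (src C f)" "Res P f y \<in> Sec P (src C f)"
      "\<mu> (src C f) (Res P f y) = \<mu> (src C f) (Res P f x)"
      using \<mu> f x y by (simp_all add: presheaf_morphism_def presheaf_def)
    then show ?thesis
      by (simp add: kernel_class_eq_iff)
  qed
  then have class_eq: "kernel P \<mu> (src C f) `` {Res P f y} = kernel P \<mu> (src C f) `` {Res P f x}"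
    if "y \<in> kernel P \<mu> (tgt C f) `` {x}" for y
    using that kernel_class[OF x] by blast
  have "Res (quot_presheaf C P (kernel P \<mu>)) f (kernel P \<mu> (tgt C f) `` {x}) =
      (\<Union>y\<in>kernel P \<mu> (tgt C f) `` {x}. kernel P \<mu> (src C f) `` {Res P f y})"
    unfolding quot_presheaf_def by (simp add: Image_eq_UN[of _ "_ ` _"])
  also have "\<dots> = (\<Union>y\<in>kernel P \<mu> (tgt C f) `` {x}. kernel P \<mu> (src C f) `` {Res P f x})"
    by (rule SUP_cong) (use class_eq in blast)+
  also have "\<dots> = kernel P \<mu> (src C f) `` {Res P f x}"
    using kernel_class[OF x] x by (intro cSUP_const) blast
  finally show ?thesis .
qed

lemma presheaf_quot_kernel:
  assumes \<mu>: "presheaf_morphism C P Q \<mu>" and C: "category C"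
  shows "presheaf C (quot_presheaf C P (kernel P \<mu>))"
proof -
  have P: "presheaf C P"
    using \<mu> by (simp add: presheaf_morphism_def)
  note res = Res_quot_kernel[OF \<mu>]
  have id: "Res (quot_presheaf C P (kernel P \<mu>)) X (kernel P \<mu> X `` {x}) = kernel P \<mu> X `` {x}"
    if "X \<in> Ob C" "x \<in> Sec P X" for X x
  proof -
    have "X \<in> Arr C" "src C X = X" "tgt C X = X"
      using Ob_arr[OF C that(1)] by auto
    then show ?thesis
      using res[of X x] P that by (simp add: presheaf_def)
  qed
  have comp: "Res (quot_presheaf C P (kernel P \<mu>)) (f \<odot>\<^bsub>C\<^esub> g) (kernel P \<mu> (tgt C f) `` {x}) =
      Res (quot_presheaf C P (kernel P \<mu>)) g
        (Res (quot_presheaf C P (kernel P \<mu>)) f (kernel P \<mu> (tgt C f) `` {x}))"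
    if fg: "f \<in> Arr C" "g \<in> Arr C" "src C f = tgt C g" and x: "x \<in> Sec P (tgt C f)" for f g x
  proof -
    have fg': "f \<odot>\<^bsub>C\<^esub> g \<in> Arr C" "src C (f \<odot>\<^bsub>C\<^esub> g) = src C g" "tgt C (f \<odot>\<^bsub>C\<^esub> g) = tgt C f"
      using C fg unfolding category_def by blast+
    have "Res P f x \<in> Sec P (tgt C g)" "Res P (f \<odot>\<^bsub>C\<^esub> g) x = Res P g (Res P f x)"
      using P fg x by (auto simp: presheaf_def)
    then show ?thesis
      using res[of "f \<odot>\<^bsub>C\<^esub> g" x] res[of f x] res[of g "Res P f x"] fg fg' x by simp
  qed
  have closed: "Res P f x \<in> Sec P (src C f)" if "f \<in> Arr C" "x \<in> Sec P (tgt C f)" for f x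
    using P that by (simp add: presheaf_def)
  show ?thesis
    unfolding presheaf_def Sec_quot_kernel using id comp closed by (auto simp: res)
qed

lemma from_quot_kernel_mono:
  assumes \<mu>: "presheaf_morphism C P Q \<mu>" and C: "category C"
  shows "presheaf_mono C (quot_presheaf C P (kernel P \<mu>)) Q (from_quot \<mu>)"
proof -
  have "Res P f x \<in> Sec P (src C f)" "\<mu> (src C f) (Res P f x) = Res Q f (\<mu> (tgt C f) x)"
    if "f \<in> Arr C" "x \<in> Sec P (tgt C f)" for f x
    using \<mu> that by (simp_all add: presheaf_def presheaf_morphism_def)
  moreover have "presheaf C Q" "\<And>X x. X \<in> Ob C \<Longrightarrow> x \<in> Sec P X \<Longrightarrow> \<mu> X x \<in> Sec Q X"
    using \<mu> by (simp_all add: presheaf_morphism_def)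
  ultimately show ?thesis
    unfolding presheaf_mono_def presheaf_morphism_def Sec_quot_kernel
    using presheaf_quot_kernel[OF \<mu> C]
    by (auto simp: from_quot_kernel Res_quot_kernel[OF \<mu>] inj_on_def kernel_class_eq_iff)
qed

text \<open>
  A map \<open>\<kappa>\<close> into \<open>P\<close> induces an isomorphism onto the quotient of \<open>P\<close> by the kernel of \<open>\<mu>\<close> as soon as
  \<open>\<mu> \<circ> \<kappa>\<close> is injective on sections and has the same image as \<open>\<mu>\<close>.
\<close>

lemma to_quot_kernel_iso:
  assumes \<mu>: "presheaf_morphism C P Q \<mu>" and \<kappa>: "presheaf_morphism C L P \<kappa>" and C: "category C"
    and inj: "\<And>X. X \<in> Ob C \<Longrightarrow> inj_on (\<lambda>x. \<mu> X (\<kappa> X x)) (Sec L X)"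
    and surj: "\<And>X y. X \<in> Ob C \<Longrightarrow> y \<in> Sec P X \<Longrightarrow> \<exists>x\<in>Sec L X. \<mu> X (\<kappa> X x) = \<mu> X y"
  shows "presheaf_iso C L (quot_presheaf C P (kernel P \<mu>)) (to_quot (kernel P \<mu>) \<kappa>)"
proof (rule presheaf_isoI)
  have L: "presheaf C L"
    and \<kappa>_in: "\<kappa> X x \<in> Sec P X" if "X \<in> Ob C" "x \<in> Sec L X" for X x
    using \<kappa> that by (simp_all add: presheaf_morphism_def)
  note ob = src_tgt_Ob[OF C]
  show "presheaf_morphism C L (quot_presheaf C P (kernel P \<mu>)) (to_quot (kernel P \<mu>) \<kappa>)"
    using \<kappa> presheaf_quot_kernel[OF \<mu> C] ob \<kappa>_in
    by (auto simp: presheaf_morphism_def to_quot_def Sec_quot_kernel Res_quot_kernel[OF \<mu>])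
  show "bij_betw (to_quot (kernel P \<mu>) \<kappa> X) (Sec L X) (Sec (quot_presheaf C P (kernel P \<mu>)) X)"
    if X: "X \<in> Ob C" for X
  proof (rule bij_betw_imageI)
    show "inj_on (to_quot (kernel P \<mu>) \<kappa> X) (Sec L X)"
      using inj[OF X] \<kappa>_in[OF X] by (simp add: inj_on_def to_quot_def kernel_class_eq_iff)
    show "to_quot (kernel P \<mu>) \<kappa> X ` Sec L X = Sec (quot_presheaf C P (kernel P \<mu>)) X"
    proof (intro equalityI subsetI)
      fix A assume "A \<in> Sec (quot_presheaf C P (kernel P \<mu>)) X"
      then obtain y where y: "y \<in> Sec P X" "A = kernel P \<mu> X `` {y}"
        by (auto simp: Sec_quot_kernel)
      obtain x where x: "x \<in> Sec L X" "\<mu> X (\<kappa> X x) = \<mu> X y"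
        using surj[OF X y(1)] by blast
      have "A = to_quot (kernel P \<mu>) \<kappa> X x"
        using x y \<kappa>_in[OF X x(1)] by (simp add: to_quot_def kernel_class_eq_iff)
      with x show "A \<in> to_quot (kernel P \<mu>) \<kappa> X ` Sec L X"
        by blast
    qed (use \<kappa>_in[OF X] in \<open>auto simp: to_quot_def Sec_quot_kernel\<close>)
  qed
qed (rule C)

lemma presheaf_hom_to: 
  assumes "category C"
  shows "presheaf C (hom_to C Y)"
  unfolding presheaf_def hom_to_def
  using category_arr[OF assms] category_comp[OF assms] category_assoc[OF assms] Ob_arr[OF assms]
  by (auto simp: hom_def)

lemma presheaf_star_pullback:
  assumes F: "covariant_functor C E star" and P: "presheaf E P"
  shows "presheaf C (star_pullback star P)"
proof -
  have ob: "star X \<in> Ob E" if "X \<in> Ob C" for X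
    using F that by (auto simp: covariant_functor_def Ob_def)
  have arr: "star f \<in> Arr E" "star (src C f) = src E (star f)" "star (tgt C f) = tgt E (star f)"
    if "f \<in> Arr C" for f
    using F that by (simp_all add: covariant_functor_def)
  have cmp: "star (f \<odot>\<^bsub>C\<^esub> g) = star f \<odot>\<^bsub>E\<^esub> star g" "src E (star f) = tgt E (star g)"
    if "f \<in> Arr C" "g \<in> Arr C" "src C f = tgt C g" for f g
    using F that arr(2)[of f] arr(3)[of g] by (simp_all add: covariant_functor_def)
  have "Res P (star (f \<odot>\<^bsub>C\<^esub> g)) x = Res P (star g) (Res P (star f) x)"
    if "f \<in> Arr C" "g \<in> Arr C" "src C f = tgt C g" "x \<in> Sec P (star (tgt C f))" for f g x
    using P that arr cmp[OF that(1-3)] by (simp add: presheaf_def)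
  moreover have "Res P (star f) x \<in> Sec P (star (src C f))"
    if "f \<in> Arr C" "x \<in> Sec P (star (tgt C f))" for f x
    using P that arr by (simp add: presheaf_def)
  moreover have "Res P (star X) x = x" if "X \<in> Ob C" "x \<in> Sec P (star X)" for X x
    using P that ob by (simp add: presheaf_def)
  ultimately show ?thesis
    unfolding presheaf_def star_pullback_def by simp
qed

lemma presheaf_prod:
  assumes "category C" and "\<And>i. i \<in> J \<Longrightarrow> presheaf C (P i)"
  shows "presheaf C (prod_presheaf J P)"
proof -
  have P: "presheaf C (P i)" if "i \<in> J" for i
    using assms(2)[OF that] .
  have id: "Res (P i) X x = x" if "i \<in> J" "X \<in> Ob C" "x \<in> Sec (P i) X" for i X x
    using P[OF that(1)] that by (simp add: presheaf_def)
  have closed: "Res (P i) f x \<in> Sec (P i) (src C f)"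
    if "i \<in> J" "f \<in> Arr C" "x \<in> Sec (P i) (tgt C f)" for i f x
    using P[OF that(1)] that by (simp add: presheaf_def)
  have comp: "Res (P i) (f \<odot>\<^bsub>C\<^esub> g) x = Res (P i) g (Res (P i) f x)"
    if "i \<in> J" "f \<in> Arr C" "g \<in> Arr C" "src C f = tgt C g" "x \<in> Sec (P i) (tgt C f)" for i f g x
    using P[OF that(1)] that by (simp add: presheaf_def)
  have "(\<lambda>i\<in>J. Res (P i) X (x i)) = x" if "X \<in> Ob C" "x \<in> (\<Pi>\<^sub>E i\<in>J. Sec (P i) X)" for X x
    by (rule PiE_ext[of _ J "\<lambda>i. Sec (P i) X"]) (use that id in \<open>auto simp: PiE_iff\<close>)
  moreover have "(\<lambda>i\<in>J. Res (P i) f (x i)) \<in> (\<Pi>\<^sub>E i\<in>J. Sec (P i) (src C f))"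
    if "f \<in> Arr C" "x \<in> (\<Pi>\<^sub>E i\<in>J. Sec (P i) (tgt C f))" for f x
    using that closed by (auto simp: PiE_iff)
  moreover have "(\<lambda>i\<in>J. Res (P i) (f \<odot>\<^bsub>C\<^esub> g) (x i)) =
      (\<lambda>i\<in>J. Res (P i) g ((\<lambda>i\<in>J. Res (P i) f (x i)) i))"
    if "f \<in> Arr C" "g \<in> Arr C" "src C f = tgt C g" "x \<in> (\<Pi>\<^sub>E i\<in>J. Sec (P i) (tgt C f))" for f g x
    using that comp by (intro restrict_ext) (simp add: PiE_iff)
  ultimately show ?thesis
    unfolding presheaf_def prod_presheaf_def by simp
qed

text \<open>The presheaf laws on \<open>P\<close> are inherited from \<open>Q\<close>; only closure under restriction needs checking.\<close>

lemma subpresheafI: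
  assumes Q: "presheaf C Q" and C: "category C"
    and sub: "\<And>X. X \<in> Ob C \<Longrightarrow> Sec P X \<subseteq> Sec Q X"
    and res: "\<And>f x. f \<in> Arr C \<Longrightarrow> x \<in> Sec P (tgt C f) \<Longrightarrow> Res P f x = Res Q f x"
    and closed: "\<And>f x. f \<in> Arr C \<Longrightarrow> x \<in> Sec P (tgt C f) \<Longrightarrow> Res P f x \<in> Sec P (src C f)"
  shows "subpresheaf C P Q"
proof -
  have "Res P X x = x" if "X \<in> Ob C" "x \<in> Sec P X" for X x
    using Q sub[OF that(1)] res[of X x] Ob_arr[OF C that(1)] that by (auto simp: presheaf_def)
  moreover have "Res P (f \<odot>\<^bsub>C\<^esub> g) x = Res P g (Res P f x)"
    if fg: "f \<in> Arr C" "g \<in> Arr C" "src C f = tgt C g" and x: "x \<in> Sec P (tgt C f)" for f g x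
  proof -
    have "Res P (f \<odot>\<^bsub>C\<^esub> g) x = Res Q (f \<odot>\<^bsub>C\<^esub> g) x"
      using category_comp[OF C fg] x by (intro res) auto
    also have "\<dots> = Res Q g (Res Q f x)"
      using Q fg sub[OF src_tgt_Ob(2)[OF C fg(1)]] x by (auto simp: presheaf_def)
    also have "\<dots> = Res P g (Res P f x)"
      using res[OF fg(1) x] res[OF fg(2), of "Res P f x"] closed[OF fg(1) x] fg(3) by simp
    finally show ?thesis .
  qed
  ultimately have "presheaf C P"
    using closed by (simp add: presheaf_def)
  with Q sub res show ?thesis
    by (simp add: subpresheaf_def)
qed

lemma subpresheaf_morphism:
  assumes "subpresheaf C P Q" and "presheaf_morphism C R Q \<tau>"
    and "\<And>X x. X \<in> Ob C \<Longrightarrow> x \<in> Sec R X \<Longrightarrow> \<tau> X x \<in> Sec P X" and "category C"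
  shows "presheaf_morphism C R P \<tau>"
  using assms src_tgt_Ob[OF assms(4)] by (simp add: subpresheaf_def presheaf_morphism_def)

lemma Sec_lim_presheaf:
  "x \<in> Sec (lim_presheaf I C F) X \<longleftrightarrow>
    x \<in> (\<Pi>\<^sub>E i\<in>Ob I. hom C X (F i)) \<and> (\<forall>f\<in>Arr I. F f \<odot>\<^bsub>C\<^esub> x (src I f) = x (tgt I f))"
  by (simp add: lim_presheaf_def set_lim_def)

lemma comp_hom:
  assumes "category C" "f \<in> hom C Y Z" "g \<in> hom C X Y"
  shows "f \<odot>\<^bsub>C\<^esub> g \<in> hom C X Z"
  using assms category_comp[of C f g] by (simp add: hom_def)

lemma functor_hom:
  assumes "covariant_functor I C F" "f \<in> hom I i j"
  shows "F f \<in> hom C (F i) (F j)"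
  using assms by (auto simp: covariant_functor_def hom_def)

lemma lim_subpresheaf:
  assumes I: "category I" and C: "category C" and F: "covariant_functor I C F"
  shows "subpresheaf C (lim_presheaf I C F) (prod_presheaf (Ob I) (\<lambda>i. hom_to C (F i)))"
proof (rule subpresheafI[OF _ C])
  show "presheaf C (prod_presheaf (Ob I) (\<lambda>i. hom_to C (F i)))"
    by (rule presheaf_prod[OF C presheaf_hom_to[OF C]])
  show "Sec (lim_presheaf I C F) X \<subseteq> Sec (prod_presheaf (Ob I) (\<lambda>i. hom_to C (F i))) X" for X
    by (auto simp: Sec_lim_presheaf prod_presheaf_def hom_to_def)
  show "Res (lim_presheaf I C F) f x = Res (prod_presheaf (Ob I) (\<lambda>i. hom_to C (F i))) f x" for f x
    by (simp add: lim_presheaf_def prod_presheaf_def hom_to_def)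
  fix h x
  assume h: "h \<in> Arr C" and x: "x \<in> Sec (lim_presheaf I C F) (tgt C h)"
  have h': "h \<in> hom C (src C h) (tgt C h)"
    using h by (simp add: hom_def)
  have xi: "x i \<in> hom C (tgt C h) (F i)" if "i \<in> Ob I" for i
    using x that by (auto simp: Sec_lim_presheaf)
  have "F f \<odot>\<^bsub>C\<^esub> (x (src I f) \<odot>\<^bsub>C\<^esub> h) = x (tgt I f) \<odot>\<^bsub>C\<^esub> h" if f: "f \<in> Arr I" for f
  proof -
    have "F f \<odot>\<^bsub>C\<^esub> (x (src I f) \<odot>\<^bsub>C\<^esub> h) = (F f \<odot>\<^bsub>C\<^esub> x (src I f)) \<odot>\<^bsub>C\<^esub> h"
      using F f h xi[OF src_tgt_Ob(1)[OF I f]]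
      by (intro category_assoc[OF C, symmetric]) (auto simp: hom_def covariant_functor_def)
    also have "F f \<odot>\<^bsub>C\<^esub> x (src I f) = x (tgt I f)"
      using x f by (simp add: Sec_lim_presheaf)
    finally show ?thesis .
  qed
  then show "Res (lim_presheaf I C F) h x \<in> Sec (lim_presheaf I C F) (src C h)"
    unfolding Sec_lim_presheaf using src_tgt_Ob[OF I] comp_hom[OF C xi h']
    by (auto simp: lim_presheaf_def)
qed


section \<open>Small categories, functors and their enlargements\<close>

lemma cat_sel:
  "Arr (cat K) = elts (s_mor K)" "src (cat K) = app (s_src K)" "tgt (cat K) = app (s_tgt K)"
  "cmp (cat K) f g = (THE h. otriple f g h \<epsilon> s_cmp K)"
  by (simp_all add: cat_def)

lemma enl_sel:
  "Arr (enl star K) = elts (star (s_mor K))"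
  "src (enl star K) = app (star (s_src K))"
  "tgt (enl star K) = app (star (s_tgt K))"
  "cmp (enl star K) f g = (THE h. otriple f g h \<epsilon> star (s_cmp K))"
  by (simp_all add: enl_def cat_def)

lemma otriple_inject [simp]:
  fixes a b c :: "'u::set_universe"
  shows "otriple a b c = otriple a' b' c' \<longleftrightarrow> a = a' \<and> b = b' \<and> c = c'"
  by (auto simp: otriple_def)

lemma small_category_category: "small_category S K \<Longrightarrow> category (cat K)"
  by (simp add: small_category_def)

lemma mem_s_mor: "f \<epsilon> s_mor K \<longleftrightarrow> f \<in> Arr (cat K)"
  by (simp add: cat_sel elts_def)

lemma mem_s_cmp:
  assumes "small_category S K"
  shows "z \<epsilon> s_cmp K \<longleftrightarrow> (\<exists>f g. f \<in> Arr (cat K) \<and> g \<in> Arr (cat K) \<and>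
    src (cat K) f = tgt (cat K) g \<and> z = otriple f g (f \<odot>\<^bsub>cat K\<^esub> g))"
proof -
  have "z \<epsilon> s_cmp K \<longleftrightarrow> z \<in> elts (s_cmp K)"
    by (simp add: elts_def)
  also have "\<dots> \<longleftrightarrow> (\<exists>f g. f \<in> Arr (cat K) \<and> g \<in> Arr (cat K) \<and>
    src (cat K) f = tgt (cat K) g \<and> z = otriple f g (f \<odot>\<^bsub>cat K\<^esub> g))"
    using assms by (auto simp: small_category_def)
  finally show ?thesis .
qed

lemma app_s_cmp:
  assumes K: "small_category S K" and fg: "f \<in> Arr (cat K)" "g \<in> Arr (cat K)"
    "src (cat K) f = tgt (cat K) g"
  shows "app (s_cmp K) (opair f g) = f \<odot>\<^bsub>cat K\<^esub> g"
  by (rule app_eqI) (use mem_s_cmp[OF K] fg in \<open>auto simp: otriple_def\<close>)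

lemma small_category_superstr:
  fixes S :: "'u::set_universe set"
  assumes S: "base_set S" and K: "small_category S K"
  shows s_mor_superstr: "s_mor K \<in> superstr S"
    and s_src_superstr: "s_src K \<in> superstr S"
    and s_tgt_superstr: "s_tgt K \<in> superstr S"
    and s_cmp_superstr: "s_cmp K \<in> superstr S"
    and Arr_superstr: "f \<in> Arr (cat K) \<Longrightarrow> f \<in> superstr S"
proof -
  show M: "s_mor K \<in> superstr S"
    using K by (simp add: small_category_def)
  note C = small_category_category[OF K]
  have "elts (s_src K) \<subseteq> {opair a b | a b. a \<in> elts (s_mor K) \<and> b \<in> elts (s_mor K)}"
    using K category_arr(1)[OF C] by (auto simp: small_category_def cat_sel(1))
  then show "s_src K \<in> superstr S"
    using relation_mem_superstr[OF S M M] K by (simp add: small_category_def)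
  have "elts (s_tgt K) \<subseteq> {opair a b | a b. a \<in> elts (s_mor K) \<and> b \<in> elts (s_mor K)}"
    using K category_arr(2)[OF C] by (auto simp: small_category_def cat_sel(1))
  then show "s_tgt K \<in> superstr S"
    using relation_mem_superstr[OF S M M] K by (simp add: small_category_def)
  obtain P where P: "P \<in> superstr S"
    "elts P = {opair a b | a b. a \<in> elts (s_mor K) \<and> b \<in> elts (s_mor K)}"
    using product_ex[OF S M M] .
  have "elts (s_cmp K) \<subseteq> {opair a b | a b. a \<in> elts P \<and> b \<in> elts (s_mor K)}"
    using mem_s_cmp[OF K] category_comp(1)[OF C] unfolding P(2)
    by (fastforce simp: elts_def mem_s_mor otriple_def)
  then show "s_cmp K \<in> superstr S"
    using relation_mem_superstr[OF S P(1) M] K by (simp add: small_category_def)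
  show "f \<in> superstr S" if "f \<in> Arr (cat K)"
    using mem_superstr[OF S M] that by (simp add: mem_s_mor)
qed

lemma app_G_Arr:
  assumes "small_functor I C G" "f \<in> Arr (cat I)"
  shows "app G f \<in> Arr (cat C)"
  using assms by (simp add: small_functor_def covariant_functor_def)

lemma small_functor_superstr:
  fixes S :: "'u::set_universe set"
  assumes S: "base_set S" and K: "small_category S I" "small_category S C"
    and G: "small_functor I C G"
  shows "G \<in> superstr S"
proof -
  have "elts G \<subseteq> {opair a b | a b. a \<in> elts (s_mor I) \<and> b \<in> elts (s_mor C)}"
    using app_G_Arr[OF G] G by (auto simp: small_functor_def cat_sel(1))
  then show ?thesis
    using relation_mem_superstr[OF S s_mor_superstr[OF S K(1)] s_mor_superstr[OF S K(2)]] G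
    by (simp add: small_functor_def)
qed

context enlarging
begin

lemmas small_superstr =
  s_mor_superstr[OF base_set_S] s_src_superstr[OF base_set_S] s_tgt_superstr[OF base_set_S]
  s_cmp_superstr[OF base_set_S] Arr_superstr[OF base_set_S]

lemma mem_star_s_mor: "f \<epsilon> star (s_mor K) \<longleftrightarrow> f \<in> Arr (enl star K)"
  by (simp add: enl_sel elts_def)

text \<open>
  The description \<open>mem_s_cmp\<close> of the composition relation is equivalent to two bounded statements, which
  describe the enlarged relation; in particular the latter is functional.
\<close>

lemma mem_star_s_cmp:
  assumes K: "small_category S K"
  shows "z \<epsilon> star (s_cmp K) \<longleftrightarrow> (\<exists>f g. f \<in> Arr (enl star K) \<and> g \<in> Arr (enl star K) \<and>
    src (enl star K) f = tgt (enl star K) g \<and> z = otriple f g (app (star (s_cmp K)) (opair f g)))"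
    (is "_ \<longleftrightarrow> ?R z")
proof
  let ?s = "App (Cst (s_src K))" and ?t = "App (Cst (s_tgt K))"
  let ?c = "\<lambda>f g. App (Cst (s_cmp K)) (Tup f g)"
  let ?M = "Cst (s_mor K)"
  note const = small_superstr[OF K]
  have "holds e (map_fm star (BAll 0 (Cst (s_cmp K)) (BEx 1 ?M (BEx 2 ?M
    (Conj (Eq (?s (Var 1)) (?t (Var 2))) (Eq (Var 0) (Tup (Tup (Var 1) (Var 2)) (?c (Var 1) (Var 2)))))))))"
    for e
    by (rule transfer_holds)
      (use const in \<open>auto simp: mem_s_cmp[OF K] mem_s_mor app_s_cmp[OF K] otriple_def cat_sel(2,3)[symmetric]\<close>)
  then show "?R z" if "z \<epsilon> star (s_cmp K)"
    using that by (auto simp: mem_star_s_mor otriple_def enl_sel(2,3)[symmetric])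
  have "holds e (map_fm star (BAll 0 ?M (BAll 1 ?M (Impl (Eq (?s (Var 0)) (?t (Var 1)))
    (Mem (Tup (Tup (Var 0) (Var 1)) (?c (Var 0) (Var 1))) (Cst (s_cmp K)))))))"
    for e
    by (rule transfer_holds)
      (use const in \<open>auto simp: mem_s_cmp[OF K] mem_s_mor app_s_cmp[OF K] otriple_def cat_sel(2,3)[symmetric]\<close>)
  then show "z \<epsilon> star (s_cmp K)" if "?R z"
    using that by (auto simp: mem_star_s_mor otriple_def enl_sel(2,3)[symmetric])
qed

lemma cmp_enl:
  assumes K: "small_category S K" and fg: "f \<in> Arr (enl star K)" "g \<in> Arr (enl star K)"
    "src (enl star K) f = tgt (enl star K) g"
  shows "f \<odot>\<^bsub>enl star K\<^esub> g = app (star (s_cmp K)) (opair f g)"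
  unfolding enl_sel(4) by (rule the_equality) (use mem_star_s_cmp[OF K] fg in auto)

lemma category_enl:
  assumes K: "small_category S K"
  shows "category (enl star K)"
proof -
  let ?s = "App (Cst (s_src K))" and ?t = "App (Cst (s_tgt K))"
  let ?c = "\<lambda>f g. App (Cst (s_cmp K)) (Tup f g)"
  let ?M = "Cst (s_mor K)"
  let ?E = "enl star K"
  note const = small_superstr[OF K]
  note C = small_category_category[OF K]
  note facts = category_arr[OF C] category_comp[OF C] category_assoc[OF C] app_s_cmp[OF K] mem_s_mor
    cat_sel(2,3)[symmetric]
  note efacts = mem_star_s_mor enl_sel(2,3)[symmetric]
  have 1: "holds e (map_fm star (BAll 0 ?M
      (Conj (Mem (?s (Var 0)) ?M) (Conj (Mem (?t (Var 0)) ?M)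
      (Conj (Eq (?s (?s (Var 0))) (?s (Var 0))) (Conj (Eq (?t (?s (Var 0))) (?s (Var 0)))
      (Conj (Eq (?s (?t (Var 0))) (?t (Var 0))) (Conj (Eq (?t (?t (Var 0))) (?t (Var 0)))
      (Conj (Eq (?c (Var 0) (?s (Var 0))) (Var 0)) (Eq (?c (?t (Var 0)) (Var 0)) (Var 0)))))))))))" for e
    by (rule transfer_holds) (use const in \<open>auto simp: facts\<close>)
  have 2: "holds e (map_fm star (BAll 0 ?M (BAll 1 ?M (Impl (Eq (?s (Var 0)) (?t (Var 1)))
      (Conj (Mem (?c (Var 0) (Var 1)) ?M)
      (Conj (Eq (?s (?c (Var 0) (Var 1))) (?s (Var 1))) (Eq (?t (?c (Var 0) (Var 1))) (?t (Var 0)))))))))" for e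
    by (rule transfer_holds) (use const in \<open>auto simp: facts\<close>)
  have 3: "holds e (map_fm star (BAll 0 ?M (BAll 1 ?M (BAll 2 ?M
      (Impl (Conj (Eq (?s (Var 0)) (?t (Var 1))) (Eq (?s (Var 1)) (?t (Var 2))))
      (Eq (?c (?c (Var 0) (Var 1)) (Var 2)) (?c (Var 0) (?c (Var 1) (Var 2)))))))))" for e
    by (rule transfer_holds) (use const in \<open>auto simp: facts\<close>)
  have E1: "src ?E f \<in> Arr ?E \<and> tgt ?E f \<in> Arr ?E \<and>
        src ?E (src ?E f) = src ?E f \<and> tgt ?E (src ?E f) = src ?E f \<and>
        src ?E (tgt ?E f) = tgt ?E f \<and> tgt ?E (tgt ?E f) = tgt ?E f \<and>
        f \<odot>\<^bsub>?E\<^esub> src ?E f = f \<and> tgt ?E f \<odot>\<^bsub>?E\<^esub> f = f" if "f \<in> Arr ?E" for f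
    using 1 that by (simp add: efacts cmp_enl[OF K])
  have E2: "f \<odot>\<^bsub>?E\<^esub> g \<in> Arr ?E \<and> src ?E (f \<odot>\<^bsub>?E\<^esub> g) = src ?E g \<and> tgt ?E (f \<odot>\<^bsub>?E\<^esub> g) = tgt ?E f"
    if "f \<in> Arr ?E" "g \<in> Arr ?E" "src ?E f = tgt ?E g" for f g
    using 2 that by (auto simp: efacts cmp_enl[OF K])
  have E3: "(f \<odot>\<^bsub>?E\<^esub> g) \<odot>\<^bsub>?E\<^esub> h = f \<odot>\<^bsub>?E\<^esub> (g \<odot>\<^bsub>?E\<^esub> h)"
    if "f \<in> Arr ?E" "g \<in> Arr ?E" "h \<in> Arr ?E" "src ?E f = tgt ?E g" "src ?E g = tgt ?E h" for f g h
  proof -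
    have "(f \<odot>\<^bsub>?E\<^esub> g) \<odot>\<^bsub>?E\<^esub> h = app (star (s_cmp K)) (opair (app (star (s_cmp K)) (opair f g)) h)"
      using E2[of f g] that by (metis cmp_enl[OF K])
    moreover have "f \<odot>\<^bsub>?E\<^esub> (g \<odot>\<^bsub>?E\<^esub> h) = app (star (s_cmp K)) (opair f (app (star (s_cmp K)) (opair g h)))"
      using E2[of g h] that by (metis cmp_enl[OF K])
    ultimately show ?thesis
      using 3 that by (auto simp: efacts)
  qed
  show ?thesis
    unfolding category_def using E1 E2 E3 by blast
qed

text \<open>The enlarging map itself is a faithful functor from \<open>cat K\<close> to its enlargement.\<close>

lemma star_functor:
  assumes K: "small_category S K"
  shows "covariant_functor (cat K) (enl star K) star"
proof -
  note const = small_superstr[OF K]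
  note C = small_category_category[OF K]
  have arr: "star f \<in> Arr (enl star K)" if "f \<in> Arr (cat K)" for f
    using star_mem_iff[of f "s_mor K"] const that by (simp add: mem_star_s_mor mem_s_mor)
  have src: "star (src (cat K) f) = src (enl star K) (star f)" if "f \<in> Arr (cat K)" for f
    using star_app[of "s_src K" f] const that category_arr(1)[OF C that] by (simp add: cat_sel enl_sel)
  have tgt: "star (tgt (cat K) f) = tgt (enl star K) (star f)" if "f \<in> Arr (cat K)" for f
    using star_app[of "s_tgt K" f] const that category_arr(2)[OF C that] by (simp add: cat_sel enl_sel)
  have cmp: "star (f \<odot>\<^bsub>cat K\<^esub> g) = star f \<odot>\<^bsub>enl star K\<^esub> star g"
    if fg: "f \<in> Arr (cat K)" "g \<in> Arr (cat K)" "src (cat K) f = tgt (cat K) g" for f g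
  proof -
    have "f \<in> superstr S" "g \<in> superstr S" "f \<odot>\<^bsub>cat K\<^esub> g \<in> superstr S"
      using const(5) category_comp(1)[OF C fg] fg by auto
    then have "star (app (s_cmp K) (opair f g)) = app (star (s_cmp K)) (opair (star f) (star g))"
      using star_app[of "s_cmp K" "opair f g"] const fg
      by (simp add: star_opair opair_superstr app_s_cmp[OF K])
    moreover have "src (enl star K) (star f) = tgt (enl star K) (star g)"
      using fg src tgt by metis
    ultimately show ?thesis
      using fg arr by (simp add: app_s_cmp[OF K] cmp_enl[OF K])
  qed
  show ?thesis
    unfolding covariant_functor_def using arr src tgt cmp by blast
qed

lemma star_inj_on_Arr:
  assumes "small_category S K"
  shows "inj_on star (Arr (cat K))"
  using small_superstr(5)[OF assms] by (auto simp: inj_on_def star_eq_iff)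

text \<open>
  A morphism between standard objects is an element of the enlargement of the set of morphisms, which
  has only standard elements when that set is finite.
\<close>

lemma hom_enl_finite:
  assumes K: "small_category S K" and X: "X \<in> Arr (cat K)" and Y: "Y \<in> Arr (cat K)"
    and fin: "finite (hom (cat K) X Y)"
  shows "hom (enl star K) (star X) (star Y) \<subseteq> star ` hom (cat K) X Y"
proof -
  define H where "H = hom (cat K) X Y"
  note const = small_superstr[OF K]
  have H: "finite H" "H \<subseteq> superstr S"
    using const(5) fin by (auto simp: H_def hom_def)
  have mem: "z \<epsilon> code_set H \<longleftrightarrow> z \<in> Arr (cat K) \<and> src (cat K) z = X \<and> tgt (cat K) z = Y" for z
    using elts_code_set_finite[OF H(1)] by (auto simp: elts_def H_def hom_def)
  have "holds e (map_fm star (BAll 0 (Cst (s_mor K))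
    (Impl (Conj (Eq (App (Cst (s_src K)) (Var 0)) (Cst X)) (Eq (App (Cst (s_tgt K)) (Var 0)) (Cst Y)))
      (Mem (Var 0) (Cst (code_set H))))))" for e
    by (rule transfer_holds)
      (use const X Y code_set_finite_superstr[OF H] in
        \<open>auto simp: mem mem_s_mor cat_sel(2,3)[symmetric]\<close>)
  then have "hom (enl star K) (star X) (star Y) \<subseteq> elts (star (code_set H))"
    by (auto simp: hom_def mem_star_s_mor enl_sel(2,3)[symmetric] elts_def)
  then show ?thesis
    using elts_star_finite[OF H] by (simp add: H_def)
qed

end

locale enlarged_functor = enlarging S W star
  for S W :: "'u::set_universe set" and star :: "'u \<Rightarrow> 'u" +
  fixes I C :: "'u small_cat" and G :: 'u
  assumes I: "small_category S I" and C: "small_category S C" and G: "small_functor I C G"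
begin

lemma G_superstr: "G \<in> superstr S"
  using small_functor_superstr[OF base_set_S I C G] .

lemma G_functor: "covariant_functor (cat I) (cat C) (app G)"
  using G by (simp add: small_functor_def)

lemma star_app_G:
  assumes "f \<in> Arr (cat I)"
  shows "app (star G) (star f) = star (app G f)"
  using star_app[of G f] G_superstr small_superstr(5)[OF I assms]
    small_superstr(5)[OF C app_G_Arr[OF G assms]] by simp

lemma star_G_functor: "covariant_functor (enl star I) (enl star C) (app (star G))"
proof -
  let ?N = "Cst (s_mor I)"
  let ?G = "App (Cst G)"
  note const = small_superstr[OF I] small_superstr[OF C] G_superstr
  note facts = mem_s_mor cat_sel(2,3)[symmetric]
  note efacts = mem_star_s_mor enl_sel(2,3)[symmetric]
  have G_arr: "app G f \<in> Arr (cat C)" "app G (src (cat I) f) = src (cat C) (app G f)"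
    "app G (tgt (cat I) f) = tgt (cat C) (app G f)" if "f \<in> Arr (cat I)" for f
    using G_functor that by (simp_all add: covariant_functor_def)
  have G_cmp: "app G (f \<odot>\<^bsub>cat I\<^esub> g) = app G f \<odot>\<^bsub>cat C\<^esub> app G g"
    if "f \<in> Arr (cat I)" "g \<in> Arr (cat I)" "src (cat I) f = tgt (cat I) g" for f g
    using G_functor that by (simp add: covariant_functor_def)
  have 1: "holds e (map_fm star (BAll 0 ?N
      (Conj (Mem (?G (Var 0)) (Cst (s_mor C)))
      (Conj (Eq (?G (App (Cst (s_src I)) (Var 0))) (App (Cst (s_src C)) (?G (Var 0))))
        (Eq (?G (App (Cst (s_tgt I)) (Var 0))) (App (Cst (s_tgt C)) (?G (Var 0))))))))" for e
    by (rule transfer_holds) (use const in \<open>auto simp: facts G_arr\<close>)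
  have 2: "holds e (map_fm star (BAll 0 ?N (BAll 1 ?N
      (Impl (Eq (App (Cst (s_src I)) (Var 0)) (App (Cst (s_tgt I)) (Var 1)))
        (Eq (?G (App (Cst (s_cmp I)) (Tup (Var 0) (Var 1))))
          (App (Cst (s_cmp C)) (Tup (?G (Var 0)) (?G (Var 1)))))))))" for e
  proof (rule transfer_holds)
    have "app G (app (s_cmp I) (opair f g)) = app (s_cmp C) (opair (app G f) (app G g))"
      if "f \<in> Arr (cat I)" "g \<in> Arr (cat I)" "src (cat I) f = tgt (cat I) g" for f g
      using that G_arr G_cmp[OF that] app_s_cmp[OF I that]
        app_s_cmp[OF C, of "app G f" "app G g"] by metis
    then show "holds e (BAll 0 ?N (BAll 1 ?N
      (Impl (Eq (App (Cst (s_src I)) (Var 0)) (App (Cst (s_tgt I)) (Var 1)))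
        (Eq (?G (App (Cst (s_cmp I)) (Tup (Var 0) (Var 1))))
          (App (Cst (s_cmp C)) (Tup (?G (Var 0)) (?G (Var 1))))))))" for e
      by (auto simp: facts)
  qed (use const in auto)
  have E1: "app (star G) f \<in> Arr (enl star C) \<and>
      app (star G) (src (enl star I) f) = src (enl star C) (app (star G) f) \<and>
      app (star G) (tgt (enl star I) f) = tgt (enl star C) (app (star G) f)"
    if "f \<in> Arr (enl star I)" for f
    using 1 that by (auto simp: efacts)
  have "app (star G) (f \<odot>\<^bsub>enl star I\<^esub> g) = app (star G) f \<odot>\<^bsub>enl star C\<^esub> app (star G) g"
    if fg: "f \<in> Arr (enl star I)" "g \<in> Arr (enl star I)" "src (enl star I) f = tgt (enl star I) g" for f g
  proof -
    have "app (star G) (app (star (s_cmp I)) (opair f g)) =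
        app (star (s_cmp C)) (opair (app (star G) f) (app (star G) g))"
      using 2 fg by (auto simp: efacts)
    then show ?thesis
      using fg E1 cmp_enl[OF I fg] cmp_enl[OF C, of "app (star G) f" "app (star G) g"] by metis
  qed
  with E1 show ?thesis
    unfolding covariant_functor_def by blast
qed

end


section \<open>The enlargement of a compatible family\<close>

text \<open>
  In the next lemmas \<open>canonical star I i X x\<close> is the value at \<open>i\<close> of the enlargement of the family \<open>x\<close>;
  all objects \<open>i\<close> of the enlarged index category are considered, not only the vertex of a cone.
\<close>

context enlarged_functor
begin

abbreviation L where "L \<equiv> lim_presheaf (cat I) (cat C) (app G)"

lemma cat_I: "category (cat I)" and cat_C: "category (cat C)"
  using I C by (simp_all add: small_category_category)

lemma enl_I: "category (enl star I)" and enl_C: "category (enl star C)"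
  using I C by (simp_all add: category_enl)

context
  fixes X x
  assumes X: "X \<in> Ob (cat C)" and x: "x \<in> Sec L X"
begin

lemma family_hom: "i \<in> Ob (cat I) \<Longrightarrow> x i \<in> hom (cat C) X (app G i)"
  using x by (auto simp: Sec_lim_presheaf)

lemma family_Arr: "i \<in> Ob (cat I) \<Longrightarrow> x i \<in> Arr (cat C)"
  using family_hom by (auto simp: hom_def)

lemma family_graph:
  shows family_graph_superstr: "graph (Ob (cat I)) x \<in> superstr S"
    and app_family_graph: "i \<in> Ob (cat I) \<Longrightarrow> app (graph (Ob (cat I)) x) i = x i"
proof -
  have "Ob (cat I) \<subseteq> elts (s_mor I)" "\<And>i. i \<in> Ob (cat I) \<Longrightarrow> x i \<in> elts (s_mor C)"
    using family_Arr by (auto simp: Ob_def cat_sel)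
  note * = graph_props[OF base_set_S small_superstr(1)[OF I] small_superstr(1)[OF C] this]
  show "graph (Ob (cat I)) x \<in> superstr S" "i \<in> Ob (cat I) \<Longrightarrow> app (graph (Ob (cat I)) x) i = x i"
    using * by auto
qed

lemma canonical_hom:
  assumes i: "i \<in> Ob (enl star I)"
  shows "canonical star I i X x \<in> hom (enl star C) (star X) (app (star G) i)"
proof -
  let ?x = "App (Cst (graph (Ob (cat I)) x)) (Var 0)"
  have const: "X \<in> superstr S"
    using X small_superstr(5)[OF C] by (auto simp: Ob_def)
  have "holds e (map_fm star (BAll 0 (Cst (s_mor I)) (Impl (Eq (App (Cst (s_src I)) (Var 0)) (Var 0))
    (Conj (Mem ?x (Cst (s_mor C))) (Conj (Eq (App (Cst (s_src C)) ?x) (Cst X))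
      (Eq (App (Cst (s_tgt C)) ?x) (App (Cst G) (Var 0))))))))" for e
  proof (rule transfer_holds)
    fix e
    have "x i \<in> Arr (cat C) \<and> src (cat C) (x i) = X \<and> tgt (cat C) (x i) = app G i"
      if "i \<in> Arr (cat I)" "src (cat I) i = i" for i
      using family_hom[of i] that by (auto simp: hom_def Ob_def)
    then show "holds e (BAll 0 (Cst (s_mor I)) (Impl (Eq (App (Cst (s_src I)) (Var 0)) (Var 0))
      (Conj (Mem ?x (Cst (s_mor C))) (Conj (Eq (App (Cst (s_src C)) ?x) (Cst X))
      (Eq (App (Cst (s_tgt C)) ?x) (App (Cst G) (Var 0)))))))"
      using app_family_graph by (auto simp: mem_s_mor cat_sel(2,3)[symmetric] Ob_def)
  qed (use const small_superstr[OF I] small_superstr[OF C] G_superstr family_graph_superstr in auto)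
  then show ?thesis
    using i by (auto simp: Ob_def hom_def canonical_def mem_star_s_mor enl_sel(2,3)[symmetric])
qed

lemma canonical_transition:
  assumes f: "f \<in> Arr (enl star I)"
  shows "app (star G) f \<odot>\<^bsub>enl star C\<^esub> canonical star I (src (enl star I) f) X x =
    canonical star I (tgt (enl star I) f) X x"
proof -
  let ?x = "App (Cst (graph (Ob (cat I)) x))"
  have "holds e (map_fm star (BAll 0 (Cst (s_mor I))
    (Eq (App (Cst (s_cmp C)) (Tup (App (Cst G) (Var 0)) (?x (App (Cst (s_src I)) (Var 0)))))
      (?x (App (Cst (s_tgt I)) (Var 0))))))" for e
  proof (rule transfer_holds)
    fix e
    have "app (s_cmp C) (opair (app G f) (x (src (cat I) f))) = x (tgt (cat I) f)"
      if "f \<in> Arr (cat I)" for f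
    proof -
      have "app (s_cmp C) (opair (app G f) (x (src (cat I) f))) = app G f \<odot>\<^bsub>cat C\<^esub> x (src (cat I) f)"
        using that family_hom[OF src_tgt_Ob(1)[OF cat_I that]] G_functor
        by (intro app_s_cmp[OF C]) (auto simp: covariant_functor_def hom_def)
      also have "\<dots> = x (tgt (cat I) f)"
        using x that by (simp add: Sec_lim_presheaf)
      finally show ?thesis .
    qed
    then show "holds e (BAll 0 (Cst (s_mor I))
      (Eq (App (Cst (s_cmp C)) (Tup (App (Cst G) (Var 0)) (?x (App (Cst (s_src I)) (Var 0)))))
      (?x (App (Cst (s_tgt I)) (Var 0)))))"
      using app_family_graph src_tgt_Ob[OF cat_I] by (auto simp: mem_s_mor cat_sel(2,3)[symmetric])
  qed (use small_superstr[OF I] small_superstr[OF C] G_superstr family_graph_superstr in auto)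
  then have "app (star (s_cmp C)) (opair (app (star G) f) (canonical star I (src (enl star I) f) X x)) =
    canonical star I (tgt (enl star I) f) X x"
    using f by (auto simp: canonical_def mem_star_s_mor enl_sel(2,3)[symmetric])
  moreover have "app (star G) f \<odot>\<^bsub>enl star C\<^esub> canonical star I (src (enl star I) f) X x =
    app (star (s_cmp C)) (opair (app (star G) f) (canonical star I (src (enl star I) f) X x))"
    using f canonical_hom[OF src_tgt_Ob(1)[OF enl_I f]] star_G_functor
    by (intro cmp_enl[OF C]) (auto simp: covariant_functor_def hom_def)
  ultimately show ?thesis
    by simp
qed

lemma canonical_star:
  assumes i: "i \<in> Ob (cat I)"
  shows "canonical star I (star i) X x = star (x i)"
  using star_app[of "graph (Ob (cat I)) x" i] family_graph_superstr app_family_graph[OF i]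
    small_superstr(5)[OF C family_Arr[OF i]] small_superstr(5)[OF I, of i] i
  by (simp add: canonical_def Ob_def)

end

lemma canonical_natural:
  assumes h: "h \<in> Arr (cat C)" and x: "x \<in> Sec L (tgt (cat C) h)" and i: "i \<in> Ob (enl star I)"
  shows "canonical star I i (src (cat C) h) (Res L h x) =
    canonical star I i (tgt (cat C) h) x \<odot>\<^bsub>enl star C\<^esub> star h"
proof -
  define y where "y = Res L h x"
  note ob = src_tgt_Ob[OF cat_C h]
  have L: "presheaf (cat C) L"
    using lim_subpresheaf[OF cat_I cat_C G_functor] by (simp add: subpresheaf_def)
  have y: "y \<in> Sec L (src (cat C) h)"
    using L h x by (simp add: presheaf_def y_def)
  let ?x = "App (Cst (graph (Ob (cat I)) x)) (Var 0)"
  let ?y = "App (Cst (graph (Ob (cat I)) y)) (Var 0)"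
  have "holds e (map_fm star (BAll 0 (Cst (s_mor I)) (Impl (Eq (App (Cst (s_src I)) (Var 0)) (Var 0))
    (Eq ?y (App (Cst (s_cmp C)) (Tup ?x (Cst h)))))))" for e
  proof (rule transfer_holds)
    fix e
    have "y i = app (s_cmp C) (opair (x i) h)" if "i \<in> Ob (cat I)" for i
    proof -
      have "app (s_cmp C) (opair (x i) h) = x i \<odot>\<^bsub>cat C\<^esub> h"
        using family_hom[OF ob(2) x that] h by (intro app_s_cmp[OF C]) (auto simp: hom_def)
      then show ?thesis
        using that by (simp add: y_def lim_presheaf_def)
    qed
    then show "holds e (BAll 0 (Cst (s_mor I)) (Impl (Eq (App (Cst (s_src I)) (Var 0)) (Var 0))
      (Eq ?y (App (Cst (s_cmp C)) (Tup ?x (Cst h))))))"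
      using app_family_graph[OF ob(2) x] app_family_graph[OF ob(1) y]
      by (auto simp: mem_s_mor cat_sel(2,3)[symmetric] Ob_def)
  qed (use h small_superstr[OF I] small_superstr[OF C]
      family_graph_superstr[OF ob(2) x] family_graph_superstr[OF ob(1) y] in auto)
  then have "canonical star I i (src (cat C) h) y =
      app (star (s_cmp C)) (opair (canonical star I i (tgt (cat C) h) x) (star h))"
    using i by (auto simp: canonical_def Ob_def mem_star_s_mor enl_sel(2,3)[symmetric])
  also have "\<dots> = canonical star I i (tgt (cat C) h) x \<odot>\<^bsub>enl star C\<^esub> star h"
    using h canonical_hom[OF ob(2) x i] star_functor[OF C]
    by (intro cmp_enl[OF C, symmetric]) (auto simp: covariant_functor_def hom_def)
  finally show ?thesis
    by (simp add: y_def)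
qed

end


section \<open>The limit and the finite part\<close>

text \<open>A cone with vertex \<open>i0\<close> over the standard objects of the enlarged index category.\<close>

locale enlarged_cone = enlarged_functor S W star I C G
  for S W :: "'u::set_universe set" and star :: "'u \<Rightarrow> 'u" and I C :: "'u small_cat" and G :: 'u +
  fixes i0 :: 'u and p :: "'u \<Rightarrow> 'u"
  assumes i0: "i0 \<in> Ob (enl star I)"
    and p_hom: "\<And>i. i \<in> Ob (cat I) \<Longrightarrow> p i \<in> hom (enl star I) i0 (star i)"
    and p_cone: "\<And>f. f \<in> Arr (cat I) \<Longrightarrow>
      star f \<odot>\<^bsub>enl star I\<^esub> p (src (cat I) f) = p (tgt (cat I) f)"
begin

abbreviation T where "T \<equiv> lim_tilde star C G i0"
abbreviation Tfin where "Tfin \<equiv> lim_fin star I C G i0 p"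
abbreviation \<kappa> where "\<kappa> \<equiv> canonical star I i0"
abbreviation \<mu> where "\<mu> \<equiv> lim_components star I C G p"
abbreviation Prod where "Prod \<equiv> prod_presheaf (Ob (cat I)) (\<lambda>i. hom_to (cat C) (app G i))"
abbreviation sProd where
  "sProd \<equiv> prod_presheaf (Ob (cat I))
    (\<lambda>i. star_pullback star (hom_to (enl star C) (app (star G) (star i))))"

lemma Sec_T: "\<phi> \<in> Sec T X \<longleftrightarrow> \<phi> \<in> hom (enl star C) (star X) (app (star G) i0)"
  and Res_T: "Res T f \<phi> = \<phi> \<odot>\<^bsub>enl star C\<^esub> star f"
  by (simp_all add: lim_tilde_def star_pullback_def hom_to_def)

lemma Sec_Tfin: "\<phi> \<in> Sec Tfin X \<longleftrightarrow> \<phi> \<in> Sec T X \<and>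
    (\<forall>i\<in>Ob (cat I). \<exists>u\<in>hom (cat C) X (app G i). app (star G) (p i) \<odot>\<^bsub>enl star C\<^esub> \<phi> = star u)"
  and Res_Tfin: "Res Tfin = Res T"
  by (simp_all add: lim_fin_def)

lemma Sec_sProd: "Sec sProd X = (\<Pi>\<^sub>E i\<in>Ob (cat I). hom (enl star C) (star X) (app (star G) (star i)))"
  and Res_sProd: "Res sProd f y = (\<lambda>i\<in>Ob (cat I). y i \<odot>\<^bsub>enl star C\<^esub> star f)"
  by (simp_all add: prod_presheaf_def star_pullback_def hom_to_def)

lemma Sec_Prod: "Sec Prod X = (\<Pi>\<^sub>E i\<in>Ob (cat I). hom (cat C) X (app G i))"
  and Res_Prod: "Res Prod f y = (\<lambda>i\<in>Ob (cat I). y i \<odot>\<^bsub>cat C\<^esub> f)"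
  by (simp_all add: prod_presheaf_def hom_to_def)

lemma G_p_hom:
  assumes "i \<in> Ob (cat I)"
  shows "app (star G) (p i) \<in> hom (enl star C) (app (star G) i0) (app (star G) (star i))"
  using functor_hom[OF star_G_functor p_hom[OF assms]] .

lemma star_G_Ob: "i \<in> Ob (cat I) \<Longrightarrow> app (star G) (star i) = star (app G i)"
  using star_app_G by (simp add: Ob_def)

lemma star_hom: "u \<in> hom (cat C) X Y \<Longrightarrow> star u \<in> hom (enl star C) (star X) (star Y)"
  using functor_hom[OF star_functor[OF C]] .

lemma star_cmp:
  assumes "f \<in> hom (cat C) Y Z" "g \<in> hom (cat C) X Y"
  shows "star (f \<odot>\<^bsub>cat C\<^esub> g) = star f \<odot>\<^bsub>enl star C\<^esub> star g"
  using star_functor[OF C] assms by (simp add: covariant_functor_def hom_def)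

lemma hom_assoc:
  assumes "category K" "f \<in> hom K Y Z" "g \<in> hom K X Y" "h \<in> hom K V X"
  shows "(f \<odot>\<^bsub>K\<^esub> g) \<odot>\<^bsub>K\<^esub> h = f \<odot>\<^bsub>K\<^esub> (g \<odot>\<^bsub>K\<^esub> h)"
  using assms by (intro category_assoc) (auto simp: hom_def)

lemma star_inject:
  assumes "u \<in> hom (cat C) X Y" "v \<in> hom (cat C) X Y" "star u = star v"
  shows "u = v"
  using star_inj_on_Arr[OF C] assms by (auto simp: hom_def inj_on_def)

lemma presheaf_T: "presheaf (cat C) T"
  unfolding lim_tilde_def
  by (rule presheaf_star_pullback[OF star_functor[OF C] presheaf_hom_to[OF enl_C]])

lemma presheaf_sProd: "presheaf (cat C) sProd"
  by (rule presheaf_prod[OF cat_C])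
    (rule presheaf_star_pullback[OF star_functor[OF C] presheaf_hom_to[OF enl_C]])

lemma presheaf_Prod: "presheaf (cat C) Prod"
  by (rule presheaf_prod[OF cat_C presheaf_hom_to[OF cat_C]])

lemma Tfin_subpresheaf: "subpresheaf (cat C) Tfin T"
proof (rule subpresheafI[OF presheaf_T cat_C])
  fix h \<phi>
  assume h: "h \<in> Arr (cat C)" and \<phi>: "\<phi> \<in> Sec Tfin (tgt (cat C) h)"
  have h': "h \<in> hom (cat C) (src (cat C) h) (tgt (cat C) h)"
    using h by (simp add: hom_def)
  have \<phi>T: "\<phi> \<in> Sec T (tgt (cat C) h)"
    using \<phi> by (simp add: Sec_Tfin)
  have "\<exists>v\<in>hom (cat C) (src (cat C) h) (app G i).
      app (star G) (p i) \<odot>\<^bsub>enl star C\<^esub> (\<phi> \<odot>\<^bsub>enl star C\<^esub> star h) = star v"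
    if i: "i \<in> Ob (cat I)" for i
  proof -
    obtain u where u: "u \<in> hom (cat C) (tgt (cat C) h) (app G i)"
      "app (star G) (p i) \<odot>\<^bsub>enl star C\<^esub> \<phi> = star u"
      using \<phi> i by (auto simp: Sec_Tfin)
    have "app (star G) (p i) \<odot>\<^bsub>enl star C\<^esub> (\<phi> \<odot>\<^bsub>enl star C\<^esub> star h) = star u \<odot>\<^bsub>enl star C\<^esub> star h"
      using hom_assoc[OF enl_C G_p_hom[OF i] \<phi>T[unfolded Sec_T] star_hom[OF h']] u(2) by simp
    then show ?thesis
      using star_cmp[OF u(1) h'] comp_hom[OF cat_C u(1) h'] by metis
  qed
  moreover have "Res T h \<phi> \<in> Sec T (src (cat C) h)"
    using presheaf_T h \<phi>T by (simp add: presheaf_def)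
  ultimately show "Res Tfin h \<phi> \<in> Sec Tfin (src (cat C) h)"
    by (simp add: Res_Tfin Sec_Tfin Res_T)
qed (auto simp: Sec_Tfin Res_Tfin)

lemma \<mu>_morphism: "presheaf_morphism (cat C) Tfin sProd \<mu>"
proof -
  have "\<mu> X \<phi> \<in> Sec sProd X" if "\<phi> \<in> Sec Tfin X" for X \<phi>
    using that comp_hom[OF enl_C G_p_hom] by (simp add: Sec_sProd lim_components_def Sec_Tfin Sec_T)
  moreover have "\<mu> (src (cat C) h) (Res Tfin h \<phi>) = Res sProd h (\<mu> (tgt (cat C) h) \<phi>)"
    if h: "h \<in> Arr (cat C)" and \<phi>: "\<phi> \<in> Sec Tfin (tgt (cat C) h)" for h \<phi>
  proof -
    have h': "h \<in> hom (cat C) (src (cat C) h) (tgt (cat C) h)"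
      using h by (simp add: hom_def)
    have "\<phi> \<in> hom (enl star C) (star (tgt (cat C) h)) (app (star G) i0)"
      using \<phi> by (simp add: Sec_Tfin Sec_T)
    then have "app (star G) (p i) \<odot>\<^bsub>enl star C\<^esub> (\<phi> \<odot>\<^bsub>enl star C\<^esub> star h) =
        (app (star G) (p i) \<odot>\<^bsub>enl star C\<^esub> \<phi>) \<odot>\<^bsub>enl star C\<^esub> star h" if "i \<in> Ob (cat I)" for i
      using hom_assoc[OF enl_C G_p_hom[OF that] _ star_hom[OF h']] by simp
    then show ?thesis
      by (auto simp: Res_Tfin Res_T Res_sProd lim_components_def intro: restrict_ext)
  qed
  ultimately show ?thesis
    using presheaf_sProd Tfin_subpresheaf by (simp add: presheaf_morphism_def subpresheaf_def)
qed

lemma sim_kernel: "lim_sim star I C G i0 p = kernel Tfin \<mu>"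
proof -
  have "\<mu> X \<phi> = \<mu> X \<psi> \<longleftrightarrow>
    (\<forall>i\<in>Ob (cat I). app (star G) (p i) \<odot>\<^bsub>enl star C\<^esub> \<phi> = app (star G) (p i) \<odot>\<^bsub>enl star C\<^esub> \<psi>)" for X \<phi> \<psi>
    by (auto simp: lim_components_def restrict_def fun_eq_iff)
  then show ?thesis
    by (auto simp: lim_sim_def kernel_def fun_eq_iff)
qed

text \<open>The transition identity of the enlarged family along the morphism \<open>p i\<close> from \<open>i0\<close> to \<open>*i\<close>.\<close>

lemma components_\<kappa>:
  assumes X: "X \<in> Ob (cat C)" and x: "x \<in> Sec L X" and i: "i \<in> Ob (cat I)"
  shows "app (star G) (p i) \<odot>\<^bsub>enl star C\<^esub> \<kappa> X x = star (x i)"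
  using canonical_transition[OF X x, of "p i"] canonical_star[OF X x i] p_hom[OF i]
  by (simp add: hom_def)

lemma \<mu>_\<kappa>:
  assumes "X \<in> Ob (cat C)" and "x \<in> Sec L X"
  shows "\<mu> X (\<kappa> X x) = (\<lambda>i\<in>Ob (cat I). star (x i))"
  using components_\<kappa>[OF assms] by (auto simp: lim_components_def intro: restrict_ext)

lemma presheaf_L: "presheaf (cat C) L"
  using lim_subpresheaf[OF cat_I cat_C G_functor] by (simp add: subpresheaf_def)

lemma \<kappa>_morphism: "presheaf_morphism (cat C) L T \<kappa>"
  unfolding presheaf_morphism_def
  using presheaf_L presheaf_T canonical_hom[OF _ _ i0] canonical_natural[OF _ _ i0]
  by (simp add: Sec_T Res_T)

lemma \<kappa>_Tfin: "presheaf_morphism (cat C) L Tfin \<kappa>"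
proof (rule subpresheaf_morphism[OF Tfin_subpresheaf \<kappa>_morphism _ cat_C])
  fix X x
  assume X: "X \<in> Ob (cat C)" and x: "x \<in> Sec L X"
  have "\<kappa> X x \<in> Sec T X"
    using \<kappa>_morphism X x by (simp add: presheaf_morphism_def)
  then show "\<kappa> X x \<in> Sec Tfin X"
    using components_\<kappa>[OF X x] family_hom[OF X x] by (auto simp: Sec_Tfin)
qed

lemma \<mu>_\<kappa>_inj:
  assumes X: "X \<in> Ob (cat C)"
  shows "inj_on (\<lambda>x. \<mu> X (\<kappa> X x)) (Sec L X)"
proof (rule inj_onI)
  fix x y
  assume x: "x \<in> Sec L X" and y: "y \<in> Sec L X" and eq: "\<mu> X (\<kappa> X x) = \<mu> X (\<kappa> X y)"
  have "star (x i) = star (y i)" if "i \<in> Ob (cat I)" for i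
    using fun_cong[OF eq, of i] that by (simp add: \<mu>_\<kappa>[OF X x] \<mu>_\<kappa>[OF X y])
  then have "x i = y i" if "i \<in> Ob (cat I)" for i
    using that star_inject[OF family_hom[OF X x that] family_hom[OF X y that]] by blast
  moreover have "x \<in> (\<Pi>\<^sub>E i\<in>Ob (cat I). hom (cat C) X (app G i))" "y \<in> (\<Pi>\<^sub>E i\<in>Ob (cat I). hom (cat C) X (app G i))"
    using x y by (simp_all add: Sec_lim_presheaf)
  ultimately show "x = y"
    by (meson PiE_ext)
qed

lemma \<kappa>_mono: "presheaf_mono (cat C) L T \<kappa>"
proof -
  have "inj_on (\<kappa> X) (Sec L X)" if "X \<in> Ob (cat C)" for X
    using \<mu>_\<kappa>_inj[OF that] by (simp add: inj_on_def)
  then show ?thesis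
    using \<kappa>_morphism by (simp add: presheaf_mono_def)
qed

text \<open>
  The family \<open>u\<close> of standard components of a member of the finite part is compatible by the cone
  identity. The canonical image of \<open>u\<close> need not be the given member, but has the same components.
\<close>

lemma \<mu>_\<kappa>_surj:
  assumes X: "X \<in> Ob (cat C)" and \<phi>: "\<phi> \<in> Sec Tfin X"
  shows "\<exists>x\<in>Sec L X. \<mu> X (\<kappa> X x) = \<mu> X \<phi>"
proof -
  let ?E = "enl star C"
  have \<phi>T: "\<phi> \<in> hom ?E (star X) (app (star G) i0)"
    using \<phi> by (simp add: Sec_Tfin Sec_T)
  obtain u where u: "\<And>i. i \<in> Ob (cat I) \<Longrightarrow>
      u i \<in> hom (cat C) X (app G i) \<and> app (star G) (p i) \<odot>\<^bsub>?E\<^esub> \<phi> = star (u i)"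
    using \<phi> unfolding Sec_Tfin by metis
  \<comment> \<open>it suffices to compare the images under \<open>star\<close>, which acts injectively on morphisms\<close>
  have compat: "app G f \<odot>\<^bsub>cat C\<^esub> u (src (cat I) f) = u (tgt (cat I) f)" if f: "f \<in> Arr (cat I)" for f
  proof -
    let ?i = "src (cat I) f" and ?j = "tgt (cat I) f"
    have i: "?i \<in> Ob (cat I)" and j: "?j \<in> Ob (cat I)"
      using src_tgt_Ob[OF cat_I f] by auto
    have f': "f \<in> hom (cat I) ?i ?j"
      using f by (simp add: hom_def)
    have Gf: "app G f \<in> hom (cat C) (app G ?i) (app G ?j)"
      using functor_hom[OF G_functor f'] .
    have sf: "star f \<in> hom (enl star I) (star ?i) (star ?j)"
      using functor_hom[OF star_functor[OF I] f'] .
    have "star (app G f \<odot>\<^bsub>cat C\<^esub> u ?i) = star (app G f) \<odot>\<^bsub>?E\<^esub> star (u ?i)"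
      using star_cmp[OF Gf] u[OF i] by blast
    also have "\<dots> = app (star G) (star f) \<odot>\<^bsub>?E\<^esub> (app (star G) (p ?i) \<odot>\<^bsub>?E\<^esub> \<phi>)"
      using u[OF i] star_app_G[OF f] by simp
    also have "\<dots> = (app (star G) (star f) \<odot>\<^bsub>?E\<^esub> app (star G) (p ?i)) \<odot>\<^bsub>?E\<^esub> \<phi>"
      using hom_assoc[OF enl_C functor_hom[OF star_G_functor sf] G_p_hom[OF i] \<phi>T] by simp
    also have "app (star G) (star f) \<odot>\<^bsub>?E\<^esub> app (star G) (p ?i) =
        app (star G) (star f \<odot>\<^bsub>enl star I\<^esub> p ?i)"
      using star_G_functor sf p_hom[OF i] by (simp add: covariant_functor_def hom_def)
    also have "\<dots> \<odot>\<^bsub>?E\<^esub> \<phi> = star (u ?j)"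
      using u[OF j] p_cone[OF f] by simp
    finally show ?thesis
      using star_inject comp_hom[OF cat_C Gf] u[OF i] u[OF j] by blast
  qed
  define x where "x = (\<lambda>i\<in>Ob (cat I). u i)"
  have x: "x \<in> Sec L X"
    using u compat src_tgt_Ob[OF cat_I] by (simp add: Sec_lim_presheaf x_def)
  have "(\<lambda>i\<in>Ob (cat I). star (x i)) = \<mu> X \<phi>"
    unfolding lim_components_def using u by (intro restrict_ext) (simp add: x_def)
  with x \<mu>_\<kappa>[OF X x] show ?thesis by auto
qed

lemma Tfin_eq_T:
  assumes X: "X \<in> Ob (cat C)" and fin: "\<And>i. i \<in> Ob (cat I) \<Longrightarrow> finite (hom (cat C) X (app G i))"
  shows "Sec Tfin X = Sec T X"
proof -
  have "\<exists>u\<in>hom (cat C) X (app G i). app (star G) (p i) \<odot>\<^bsub>enl star C\<^esub> \<phi> = star u"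
    if \<phi>: "\<phi> \<in> Sec T X" and i: "i \<in> Ob (cat I)" for \<phi> i
  proof -
    have "app (star G) (p i) \<odot>\<^bsub>enl star C\<^esub> \<phi> \<in> hom (enl star C) (star X) (star (app G i))"
      using comp_hom[OF enl_C G_p_hom[OF i]] \<phi> star_G_Ob[OF i] by (simp add: Sec_T)
    moreover have "X \<in> Arr (cat C)" "app G i \<in> Arr (cat C)"
      using X i app_G_Arr[OF G] by (auto simp: Ob_def)
    ultimately show ?thesis
      using hom_enl_finite[OF C _ _ fin[OF i]] by blast
  qed
  then show ?thesis
    by (auto simp: Sec_Tfin)
qed

lemma projections_mono: "presheaf_mono (cat C) L Prod (projections I)"
proof -
  have sub: "subpresheaf (cat C) L Prod"
    using lim_subpresheaf[OF cat_I cat_C G_functor] .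
  have "projections I X x = x" if "x \<in> Sec L X" for X x
    using that by (auto simp: projections_def Sec_lim_presheaf PiE_iff)
  then have id: "projections I X x = x" "x \<in> Sec Prod X" if "x \<in> Sec L X" for X x
    using that by (auto simp: Sec_lim_presheaf Sec_Prod)
  have "Res L h x \<in> Sec L (src (cat C) h)" if "h \<in> Arr (cat C)" "x \<in> Sec L (tgt (cat C) h)" for h x
    using presheaf_L that by (simp add: presheaf_def)
  then show ?thesis
    using sub id by (simp add: presheaf_mono_def presheaf_morphism_def subpresheaf_def inj_on_def)
qed

lemma star_family_morphism: "presheaf_morphism (cat C) Prod sProd (star_family star I)"
proof -
  have "star_family star I X x \<in> Sec sProd X" if "x \<in> Sec Prod X" for X x
    using that star_hom by (auto simp: star_family_def Sec_Prod Sec_sProd star_G_Ob PiE_iff)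
  moreover have "star_family star I (src (cat C) h) (Res Prod h x) =
      Res sProd h (star_family star I (tgt (cat C) h) x)"
    if h: "h \<in> Arr (cat C)" and x: "x \<in> Sec Prod (tgt (cat C) h)" for h x
  proof -
    have h': "h \<in> hom (cat C) (src (cat C) h) (tgt (cat C) h)"
      using h by (simp add: hom_def)
    have "star (x i \<odot>\<^bsub>cat C\<^esub> h) = star (x i) \<odot>\<^bsub>enl star C\<^esub> star h" if "i \<in> Ob (cat I)" for i
      using star_cmp[OF _ h'] x that by (auto simp: Sec_Prod PiE_iff)
    then show ?thesis
      by (auto simp: star_family_def Res_Prod Res_sProd intro: restrict_ext)
  qed
  ultimately show ?thesis
    using presheaf_Prod presheaf_sProd by (simp add: presheaf_morphism_def)
qed

lemma lim_comparison:
  "subpresheaf (cat C) Tfin T \<and>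
   presheaf_equiv (cat C) Tfin (lim_sim star I C G i0 p) \<and>
   presheaf_mono (cat C) L T \<kappa> \<and>
   presheaf_morphism (cat C) L Tfin \<kappa> \<and>
   presheaf_iso (cat C) L (quot_presheaf (cat C) Tfin (lim_sim star I C G i0 p))
     (to_quot (lim_sim star I C G i0 p) \<kappa>) \<and>
   ((\<forall>X\<in>Ob (cat C). \<forall>i\<in>Ob (cat I). finite (hom (cat C) X (app G i)))
      \<longrightarrow> (\<forall>X\<in>Ob (cat C). Sec Tfin X = Sec T X)) \<and>
   presheaf_mono (cat C) (quot_presheaf (cat C) Tfin (lim_sim star I C G i0 p)) sProd (from_quot \<mu>) \<and>
   (\<forall>X\<in>Ob (cat C). \<forall>\<phi>\<in>Sec Tfin X.
      from_quot \<mu> X (lim_sim star I C G i0 p X `` {\<phi>}) = \<mu> X \<phi>) \<and>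
   presheaf_mono (cat C) L Prod (projections I) \<and>
   presheaf_morphism (cat C) Prod sProd (star_family star I) \<and>
   (\<forall>X\<in>Ob (cat C). \<forall>x\<in>Sec L X.
      from_quot \<mu> X (to_quot (lim_sim star I C G i0 p) \<kappa> X x) =
        star_family star I X (projections I X x))"
proof -
  have "from_quot \<mu> X (to_quot (kernel Tfin \<mu>) \<kappa> X x) = star_family star I X (projections I X x)"
    if X: "X \<in> Ob (cat C)" and x: "x \<in> Sec L X" for X x
  proof -
    have "\<kappa> X x \<in> Sec Tfin X"
      using \<kappa>_Tfin X x by (simp add: presheaf_morphism_def)
    then have "from_quot \<mu> X (to_quot (kernel Tfin \<mu>) \<kappa> X x) = \<mu> X (\<kappa> X x)"
      by (simp add: to_quot_def from_quot_kernel)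
    also have "\<dots> = star_family star I X (projections I X x)"
      unfolding \<mu>_\<kappa>[OF X x] by (auto simp: star_family_def projections_def intro: restrict_ext)
    finally show ?thesis .
  qed
  then show ?thesis
    unfolding sim_kernel
    using Tfin_subpresheaf presheaf_equiv_kernel[OF \<mu>_morphism] \<kappa>_mono \<kappa>_Tfin
      to_quot_kernel_iso[OF \<mu>_morphism \<kappa>_Tfin cat_C \<mu>_\<kappa>_inj \<mu>_\<kappa>_surj] Tfin_eq_T
      from_quot_kernel_mono[OF \<mu>_morphism cat_C] projections_mono star_family_morphism
    by (simp add: from_quot_kernel)
qed

end

section \<open>Duality\<close>

lemma opp_sel [simp]:
  "Arr (opp K) = Arr K" "src (opp K) = tgt K" "tgt (opp K) = src K" "cmp (opp K) f g = cmp K g f"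
  by (simp_all add: opp_def)

lemma hom_opp [simp]: "hom (opp K) X Y = hom K Y X"
  by (auto simp: hom_def)

lemma hom_to_opp: "hom_to (opp K) Y = hom_from K Y"
  by (simp add: hom_to_def hom_from_def)

lemma Ob_opp:
  assumes "category K"
  shows "Ob (opp K) = Ob K"
proof -
  have "src K f = f \<longleftrightarrow> tgt K f = f" if "f \<in> Arr K" for f
    using category_arr(4,5)[OF assms that] by auto
  then show ?thesis
    by (auto simp: Ob_def)
qed

lemma category_opp:
  assumes "category K"
  shows "category (opp K)"
  unfolding category_def opp_sel
  using category_arr[OF assms] category_comp[OF assms] category_assoc[OF assms] by auto

lemma covariant_functor_opp:
  assumes "covariant_functor I C F"
  shows "covariant_functor (opp I) (opp C) F"
  using assms by (auto simp: covariant_functor_def)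

text \<open>The opposite small category; its composition relation has the first two entries of triples swapped.\<close>

definition op_small :: "'u::set_universe small_cat \<Rightarrow> 'u small_cat" where
  "op_small K = \<lparr>s_mor = s_mor K, s_src = s_tgt K, s_tgt = s_src K,
     s_cmp = code_set {otriple g f h | f g h. otriple f g h \<epsilon> s_cmp K}\<rparr>"

context enlarging
begin

context
  fixes K
  assumes K: "small_category S K"
begin

lemma s_cmp_op_small:
  shows mem_s_cmp_op_small: "z \<epsilon> s_cmp (op_small K) \<longleftrightarrow> (\<exists>f g h. z = otriple g f h \<and> otriple f g h \<epsilon> s_cmp K)"
    and is_set_s_cmp_op_small: "is_set (s_cmp (op_small K))"
proof -
  define R where "R = {otriple g f h | f g h. otriple f g h \<epsilon> s_cmp K}"
  note M = small_superstr(1)[OF K]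
  obtain P where P: "P \<in> superstr S"
    "elts P = {opair a b | a b. a \<in> elts (s_mor K) \<and> b \<in> elts (s_mor K)}"
    using product_ex[OF base_set_S M M] .
  have "R \<subseteq> {opair a b | a b. a \<in> elts P \<and> b \<in> elts (s_mor K)}"
    using mem_s_cmp[OF K] category_comp(1)[OF small_category_category[OF K]] unfolding P(2) R_def
    by (fastforce simp: elts_def mem_s_mor otriple_def)
  note * = relation_code_set[OF base_set_S P(1) M this]
  have s: "s_cmp (op_small K) = code_set R"
    by (simp add: op_small_def R_def)
  show "is_set (s_cmp (op_small K))"
    using * s by simp
  have "z \<epsilon> s_cmp (op_small K) \<longleftrightarrow> z \<in> elts (code_set R)"
    by (simp add: s elts_def)
  then show "z \<epsilon> s_cmp (op_small K) \<longleftrightarrow> (\<exists>f g h. z = otriple g f h \<and> otriple f g h \<epsilon> s_cmp K)"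
    unfolding *(2) by (auto simp: R_def)
qed

lemma cat_op_small: "cat (op_small K) = opp (cat K)"
proof -
  have "otriple f g h \<epsilon> s_cmp (op_small K) \<longleftrightarrow> otriple g f h \<epsilon> s_cmp K" for f g h
    by (auto simp: mem_s_cmp_op_small)
  then show ?thesis
    by (simp add: cat_def opp_def) (simp add: op_small_def)
qed

lemma small_category_op_small: "small_category S (op_small K)"
proof -
  have "elts (s_cmp (op_small K)) = {otriple f g (f \<odot>\<^bsub>opp (cat K)\<^esub> g) | f g.
        f \<in> Arr (opp (cat K)) \<and> g \<in> Arr (opp (cat K)) \<and> src (opp (cat K)) f = tgt (opp (cat K)) g}"
    unfolding elts_def mem_s_cmp_op_small mem_s_cmp[OF K] opp_sel otriple_inject
    by (rule Collect_cong) metis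
  then show ?thesis
    using K is_set_s_cmp_op_small category_opp[OF small_category_category[OF K]]
    unfolding small_category_def cat_op_small by (simp add: op_small_def)
qed

lemma enl_op_small: "enl star (op_small K) = opp (enl star K)"
proof -
  let ?K' = "op_small K"
  note const = small_superstr[OF K] small_superstr(4)[OF small_category_op_small]
  have sel: "s_mor ?K' = s_mor K" "s_src ?K' = s_tgt K" "s_tgt ?K' = s_src K"
    by (simp_all add: op_small_def)
  have arr: "Arr (enl star ?K') = Arr (enl star K)"
    by (simp add: enl_sel sel)
  \<comment> \<open>both enlarged composition relations consist of triples of morphisms, so bounded quantifiers suffice\<close>
  have triple: "f \<in> Arr (enl star L) \<and> g \<in> Arr (enl star L) \<and> h \<in> Arr (enl star L)"
    if "small_category S L" "otriple f g h \<epsilon> star (s_cmp L)" for L f g h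
  proof -
    have "f \<in> Arr (enl star L)" "g \<in> Arr (enl star L)" "src (enl star L) f = tgt (enl star L) g"
      "h = app (star (s_cmp L)) (opair f g)"
      using that(2) unfolding mem_star_s_cmp[OF that(1)] by auto
    then show ?thesis
      using cmp_enl[OF that(1)] category_comp(1)[OF category_enl[OF that(1)]] by metis
  qed
  let ?t = "Tup (Tup (Var 0) (Var 1)) (Var 2)" and ?t' = "Tup (Tup (Var 1) (Var 0)) (Var 2)"
  have "holds e (map_fm star (BAll 0 (Cst (s_mor K)) (BAll 1 (Cst (s_mor K)) (BAll 2 (Cst (s_mor K))
      (Conj (Impl (Mem ?t (Cst (s_cmp ?K'))) (Mem ?t' (Cst (s_cmp K))))
        (Impl (Mem ?t' (Cst (s_cmp K))) (Mem ?t (Cst (s_cmp ?K')))))))))" for e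
    by (rule transfer_holds) (use const in \<open>auto simp: mem_s_cmp_op_small otriple_def\<close>)
  then have "otriple f g h \<epsilon> star (s_cmp ?K') \<longleftrightarrow> otriple g f h \<epsilon> star (s_cmp K)"
    if "f \<in> Arr (enl star K)" "g \<in> Arr (enl star K)" "h \<in> Arr (enl star K)" for f g h
    using that by (auto simp: mem_star_s_mor otriple_def)
  then have "otriple f g h \<epsilon> star (s_cmp ?K') \<longleftrightarrow> otriple g f h \<epsilon> star (s_cmp K)" for f g h
    using triple[OF K] triple[OF small_category_op_small] arr by metis
  then show ?thesis
    by (simp add: enl_def cat_def opp_def sel)
qed

end

end

context enlarged_functor
begin

lemma enlarged_functor_opp: "enlarged_functor S W star (op_small I) (op_small C) G"
proof -
  have "small_functor (op_small I) (op_small C) G"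
    using G covariant_functor_opp[OF G_functor]
    by (simp add: small_functor_def cat_op_small[OF I] cat_op_small[OF C])
  then show ?thesis
    using small_category_op_small I C by unfold_locales auto
qed

text \<open>
  The data attached to a colimit are literally those attached to the limit over the opposite categories.
\<close>

lemma colim_as_lim:
  "colim_presheaf (cat I) (cat C) (app G) =
     lim_presheaf (cat (op_small I)) (cat (op_small C)) (app G)"
  "colim_tilde star C G i0 = lim_tilde star (op_small C) G i0"
  "colim_fin star I C G i0 q = lim_fin star (op_small I) (op_small C) G i0 q"
  "colim_components star I C G q = lim_components star (op_small I) (op_small C) G q"
  "colim_sim star I C G i0 q = lim_sim star (op_small I) (op_small C) G i0 q"
  "canonical star (op_small I) i0 = canonical star I i0"
  "projections (op_small I) = projections I"
  "star_family star (op_small I) = star_family star I"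
proof -
  note eqs = cat_op_small[OF I] cat_op_small[OF C] enl_op_small[OF I] enl_op_small[OF C]
    Ob_opp[OF cat_I]
  show "colim_presheaf (cat I) (cat C) (app G) =
     lim_presheaf (cat (op_small I)) (cat (op_small C)) (app G)"
    by (simp add: colim_presheaf_def lim_presheaf_def eqs)
  show T: "colim_tilde star C G i0 = lim_tilde star (op_small C) G i0"
    by (simp add: colim_tilde_def lim_tilde_def hom_from_def hom_to_def eqs)
  show fin: "colim_fin star I C G i0 q = lim_fin star (op_small I) (op_small C) G i0 q"
    by (simp add: colim_fin_def lim_fin_def T eqs)
  show "colim_components star I C G q = lim_components star (op_small I) (op_small C) G q"
    by (simp add: colim_components_def lim_components_def eqs fun_eq_iff)
  show "colim_sim star I C G i0 q = lim_sim star (op_small I) (op_small C) G i0 q"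
    by (simp add: colim_sim_def lim_sim_def fin eqs fun_eq_iff)
  show "canonical star (op_small I) i0 = canonical star I i0"
    "projections (op_small I) = projections I" "star_family star (op_small I) = star_family star I"
    by (simp_all add: canonical_def projections_def star_family_def eqs fun_eq_iff)
qed

end

theorem corollary3p6:
  fixes S W :: "'u::set_universe set" and star :: "'u \<Rightarrow> 'u"
    and I C :: "'u small_cat" and G :: 'u
  assumes "enlargement S W star"
    and "small_category S I" and "small_category S C" and "small_functor I C G"
  shows
    "(\<forall>i0 p.
        cofiltered (cat I) \<and> i0 \<in> Ob (enl star I) \<and>
        (\<forall>i\<in>Ob (cat I). p i \<in> hom (enl star I) i0 (star i)) \<and>
        (\<forall>f\<in>Arr (cat I). star f \<odot>\<^bsub>enl star I\<^esub> p (src (cat I) f) = p (tgt (cat I) f))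
      \<longrightarrow>
        (let L = lim_presheaf (cat I) (cat C) (app G);
             T = lim_tilde star C G i0;
             Tfin = lim_fin star I C G i0 p;
             sim = lim_sim star I C G i0 p;
             Q = quot_presheaf (cat C) Tfin sim;
             \<kappa> = canonical star I i0;
             \<mu> = lim_components star I C G p;
             Prod = prod_presheaf (Ob (cat I)) (\<lambda>i. hom_to (cat C) (app G i));
             sProd = prod_presheaf (Ob (cat I))
                       (\<lambda>i. star_pullback star (hom_to (enl star C) (app (star G) (star i))))
         in subpresheaf (cat C) Tfin T \<and>
            presheaf_equiv (cat C) Tfin sim \<and>
            presheaf_mono (cat C) L T \<kappa> \<and>
            presheaf_morphism (cat C) L Tfin \<kappa> \<and>
            presheaf_iso (cat C) L Q (to_quot sim \<kappa>) \<and>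
            ((\<forall>X\<in>Ob (cat C). \<forall>i\<in>Ob (cat I). finite (hom (cat C) X (app G i)))
               \<longrightarrow> (\<forall>X\<in>Ob (cat C). Sec Tfin X = Sec T X)) \<and>
            presheaf_mono (cat C) Q sProd (from_quot \<mu>) \<and>
            (\<forall>X\<in>Ob (cat C). \<forall>\<phi>\<in>Sec Tfin X. from_quot \<mu> X (sim X `` {\<phi>}) = \<mu> X \<phi>) \<and>
            presheaf_mono (cat C) L Prod (projections I) \<and>
            presheaf_morphism (cat C) Prod sProd (star_family star I) \<and>
            (\<forall>X\<in>Ob (cat C). \<forall>x\<in>Sec L X.
               from_quot \<mu> X (to_quot sim \<kappa> X x) = star_family star I X (projections I X x))))
   \<and>
     (\<forall>i0 q.
        filtered (cat I) \<and> i0 \<in> Ob (enl star I) \<and>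
        (\<forall>i\<in>Ob (cat I). q i \<in> hom (enl star I) (star i) i0) \<and>
        (\<forall>f\<in>Arr (cat I). q (tgt (cat I) f) \<odot>\<^bsub>enl star I\<^esub> star f = q (src (cat I) f))
      \<longrightarrow>
        (let L = colim_presheaf (cat I) (cat C) (app G);
             T = colim_tilde star C G i0;
             Tfin = colim_fin star I C G i0 q;
             sim = colim_sim star I C G i0 q;
             Cop = opp (cat C);
             Q = quot_presheaf Cop Tfin sim;
             \<kappa> = canonical star I i0;
             \<mu> = colim_components star I C G q;
             Prod = prod_presheaf (Ob (cat I)) (\<lambda>i. hom_from (cat C) (app G i));
             sProd = prod_presheaf (Ob (cat I))
                       (\<lambda>i. star_pullback star (hom_from (enl star C) (app (star G) (star i))))
         in subpresheaf Cop Tfin T \<and>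
            presheaf_equiv Cop Tfin sim \<and>
            presheaf_mono Cop L T \<kappa> \<and>
            presheaf_morphism Cop L Tfin \<kappa> \<and>
            presheaf_iso Cop L Q (to_quot sim \<kappa>) \<and>
            ((\<forall>X\<in>Ob (cat C). \<forall>i\<in>Ob (cat I). finite (hom (cat C) (app G i) X))
               \<longrightarrow> (\<forall>X\<in>Ob (cat C). Sec Tfin X = Sec T X)) \<and>
            presheaf_mono Cop Q sProd (from_quot \<mu>) \<and>
            (\<forall>X\<in>Ob (cat C). \<forall>\<phi>\<in>Sec Tfin X. from_quot \<mu> X (sim X `` {\<phi>}) = \<mu> X \<phi>) \<and>
            presheaf_mono Cop L Prod (projections I) \<and>
            presheaf_morphism Cop Prod sProd (star_family star I) \<and>
            (\<forall>X\<in>Ob (cat C). \<forall>x\<in>Sec L X.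
               from_quot \<mu> X (to_quot sim \<kappa> X x) = star_family star I X (projections I X x))))"
proof -
  interpret enlarged_functor S W star I C G
    using assms by unfold_locales
  show ?thesis
  proof (intro conjI allI impI, goal_cases)
    case (1 i0 p)
    then interpret enlarged_cone S W star I C G i0 p
      by unfold_locales auto
    show ?case
      unfolding Let_def by (rule lim_comparison)
  next
    case (2 i0 q)
    interpret dual: enlarged_functor S W star "op_small I" "op_small C" G
      by (rule enlarged_functor_opp)
    interpret dual: enlarged_cone S W star "op_small I" "op_small C" G i0 q
      using 2 Ob_opp[OF cat_I] Ob_opp[OF enl_I]
      by unfold_locales (auto simp: cat_op_small[OF I] enl_op_small[OF I])
    show ?case
      using dual.lim_comparison
      unfolding Let_def colim_as_lim cat_op_small[OF I] cat_op_small[OF C] enl_op_small[OF C]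
        Ob_opp[OF cat_I] Ob_opp[OF cat_C] hom_opp hom_to_opp .
  qed
qed

end
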